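(* Let $r>1$. The element $$C=\prod_{\zeta\in\Xi}\ \prod_{a=1}^p\bigl(y-(\zeta+a)x\bigr)$$ (the inner product being taken with $a=1,\dots,p$ from left to right, the outer product in any order) belongs to the center $Z_{g_1}$ of $H_{g_1}$. Thus $$Z_{g_1}\cong\frac{k[A,B,C]}{(A^p-B^2)},$$ where $A,B,C$ correspond to the central elements $A=x^2-2g_1+2$, $B=x^p$ and $C$ of $H_{g_1}$.
   Context: Let $p$ be an odd prime, $q=p^r$, $k=\overline{\mathbb F}_q$, and $E=\left\{\begin{pmatrix}1&a\\0&1\end{pmatrix}: a\in\mathbb F_q\right\}\cong(\mathbb Z/p)^r$. Let $\xi$ generate $\mathbb F_q^\times$; $1,\xi,\dots,\xi^{r-1}$ is an $\mathbb F_p$-basis of $\mathbb F_q$, and $\Xi$ is the $\mathbb F_p$-linear span of $\xi,\xi^2,\dots,\xi^{r-1}$. Put $g_i=\begin{pmatrix}1&\xi^{i-1}\\0&1\end{pmatrix}$, so $g_1=\begin{pmatrix}1&1\\0&1\end{pmatrix}$. $E$ acts on $k\langle x,y\rangle$ by algebra automorphisms, $\begin{pmatrix}1&a\\0&1\end{pmatrix}$ fixing $x$ and sending $y\mapsto y+ax$; $k\langle x,y\rangle\rtimes E$ is the smash product, and $H_{g_1}=(k\langle x,y\rangle\rtimes E)/(xy-yx-g_1)$. *)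

theory Defs
  imports
    "HOL-Analysis.Finite_Cartesian_Product"
    "HOL-Analysis.Cartesian_Space"
    "HOL-Library.Poly_Mapping"
    "HOL-Algebra.QuotRing"
    "HOL-Algebra.Algebraic_Closure_Type"
begin

text \<open>
  In the intended use \<open>'f\<close> is the field with \<open>q\<close> elements, and \<open>'f alg_closure\<close> is the field \<open>k\<close>.
\<close>

section \<open>The group of unipotent matrices\<close>

definition unip_mat :: "'f::field \<Rightarrow> 'f ^ 2 ^ 2" where
  "unip_mat a = vector [vector [1, a], vector [0, 1]]"

typedef (overloaded) 'f unip = "range (unip_mat :: 'f::field \<Rightarrow> 'f ^ 2 ^ 2)"
  morphisms mat_of Unip
  by auto

setup_lifting type_definition_unip

lemma unip_mat_nth [simp]:
  "vec_nth (vec_nth (unip_mat a) 1) 1 = 1" "vec_nth (vec_nth (unip_mat a) 1) 2 = a"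
  "vec_nth (vec_nth (unip_mat a) 2) 1 = 0" "vec_nth (vec_nth (unip_mat a) 2) 2 = 1"
  by (simp_all add: unip_mat_def)

lemma unip_mat_mult: "unip_mat a ** unip_mat b = unip_mat (a + b)"
  by (simp add: vec_eq_iff matrix_matrix_mult_def forall_2 sum_2)

lemma unip_mat_0: "unip_mat 0 = mat 1"
  by (simp add: vec_eq_iff mat_def forall_2)

instantiation unip :: (field) monoid_mult
begin

lift_definition one_unip :: "'a unip" is "mat 1"
  by (metis unip_mat_0 rangeI)

lift_definition times_unip :: "'a unip \<Rightarrow> 'a unip \<Rightarrow> 'a unip" is "(**)"
  by (auto simp: unip_mat_mult)

instance
  by standard (transfer, simp add: matrix_mul_assoc)+

end

lift_definition unip_elt :: "'f::field \<Rightarrow> 'f unip" is unip_mat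
  by simp

lift_definition entry :: "'f::field unip \<Rightarrow> 'f" is "\<lambda>M. vec_nth (vec_nth M 1) 2" .

lemma entry_unip_elt [simp]: "entry (unip_elt a) = a"
  by transfer simp

lemma entry_one [simp]: "entry 1 = 0"
  by transfer (simp add: mat_def)

lemma entry_mult [simp]: "entry (g * h) = entry g + entry h"
  by transfer (auto simp: unip_mat_mult)

section \<open>The free algebra on two generators\<close>

datatype gen = GX | GY

datatype word = Word (letters: "gen list")

instantiation word :: monoid_add
begin

definition "0 = Word []"
definition "u + v = Word (letters u @ letters v)"

instance
  by standard (simp_all add: zero_word_def plus_word_def)

end

lemma letters_zero [simp]: "letters 0 = []"
  by (simp add: zero_word_def)

lemma letters_plus [simp]: "letters (u + v) = letters u @ letters v"
  by (simp add: plus_word_def)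

text \<open>
  The free algebra is the monoid algebra of the free monoid; its product is the convolution
  product of \<^type>\<open>poly_mapping\<close>.
\<close>

type_synonym 'f free_alg = "word \<Rightarrow>\<^sub>0 'f alg_closure"

definition fconst :: "'f::field alg_closure \<Rightarrow> 'f free_alg" where
  "fconst c = Poly_Mapping.single 0 c"

definition fgen :: "gen \<Rightarrow> 'f::field free_alg" where
  "fgen i = Poly_Mapping.single (Word [i]) 1"

text \<open>The unique algebra endomorphism with prescribed values on the generators.\<close>

definition free_lift :: "(gen \<Rightarrow> 'f::field free_alg) \<Rightarrow> 'f free_alg \<Rightarrow> 'f free_alg" where
  "free_lift \<phi> u =
     (\<Sum>w\<in>Poly_Mapping.keys u. fconst (Poly_Mapping.lookup u w) * prod_list (map \<phi> (letters w)))"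

definition act :: "'f::field unip \<Rightarrow> 'f free_alg \<Rightarrow> 'f free_alg" where
  "act g = free_lift
     (\<lambda>i. case i of GX \<Rightarrow> fgen GX | GY \<Rightarrow> fgen GY + fconst (to_ac (entry g)) * fgen GX)"

lemma pm_induct [case_names zero single add]:
  assumes "P 0" and "\<And>k v. P (Poly_Mapping.single k v)" and "\<And>a b. P a \<Longrightarrow> P b \<Longrightarrow> P (a + b)"
  shows "P (f :: 'a \<Rightarrow>\<^sub>0 'b::comm_monoid_add)"
proof (induction f rule: update_induct)
  case const
  then show ?case by (simp add: assms(1))
next
  case (update f a b)
  have "Poly_Mapping.update a b f = f + Poly_Mapping.single a b"
    using update.hyps
    by (intro poly_mapping_eqI)
      (auto simp: lookup_update lookup_add lookup_single when_def in_keys_iff)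
  then show ?case
    using update.IH assms(2,3) by simp
qed

lemma fconst_simps:
  "fconst 0 = 0" "fconst 1 = 1" "fconst (a + b) = fconst a + fconst b"
  "fconst (a * b) = fconst a * fconst b"
  by (simp_all add: fconst_def single_add mult_single)

lemma fconst_central: "fconst c * u = u * fconst c"
  by (induction u rule: pm_induct)
    (simp_all add: algebra_simps fconst_def mult_single)

lemma free_lift_zero [simp]: "free_lift \<phi> 0 = 0"
  by (simp add: free_lift_def)

lemma free_lift_single [simp]:
  "free_lift \<phi> (Poly_Mapping.single w c) = fconst c * prod_list (map \<phi> (letters w))"
  by (cases "c = 0") (simp_all add: free_lift_def fconst_simps)

lemma free_lift_add [simp]: "free_lift \<phi> (u + v) = free_lift \<phi> u + free_lift \<phi> v"
  unfolding free_lift_def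
  by (rule setsum_keys_plus_distrib) (simp_all add: fconst_simps distrib_right)

lemma free_lift_mult [simp]: "free_lift \<phi> (u * v) = free_lift \<phi> u * free_lift \<phi> v"
proof (induction u rule: pm_induct)
  case (single w c)
  show ?case
  proof (induction v rule: pm_induct)
    case (single w' c')
    show ?case
      by (simp add: mult_single fconst_simps mult.assoc)
        (metis fconst_central mult.assoc)
  qed (simp_all add: distrib_left)
qed (simp_all add: distrib_right)

lemma free_lift_one [simp]: "free_lift \<phi> 1 = 1"
  unfolding single_one[symmetric] free_lift_single by (simp add: fconst_simps)

lemma free_lift_fconst [simp]: "free_lift \<phi> (fconst c) = fconst c"
  by (simp add: fconst_def)

lemma free_lift_fgen [simp]: "free_lift \<phi> (fgen i) = \<phi> i"
  by (simp add: fgen_def fconst_simps)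

lemma free_lift_prod_list: "free_lift \<phi> (prod_list us) = prod_list (map (free_lift \<phi>) us)"
  by (induction us) simp_all

lemma free_lift_comp: "free_lift \<phi> (free_lift \<psi> u) = free_lift (\<lambda>i. free_lift \<phi> (\<psi> i)) u"
  by (induction u rule: pm_induct) (simp_all add: free_lift_prod_list comp_def)

lemma prod_list_fgen: "prod_list (map fgen js) = Poly_Mapping.single (Word js) 1"
proof (induction js)
  case Nil
  then show ?case by (simp flip: zero_word_def)
next
  case (Cons i js)
  then show ?case by (simp add: fgen_def mult_single plus_word_def)
qed

lemma free_lift_fgen_id: "free_lift fgen u = u"
  by (induction u rule: pm_induct)
    (simp_all add: prod_list_fgen fconst_def mult_single)

lemma act_fgen:
  "act g (fgen GX) = fgen GX"
  "act g (fgen GY) = fgen GY + fconst (to_ac (entry g)) * fgen GX"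
  by (simp_all add: act_def)

lemma act_simps [simp]:
  "act g 0 = 0" "act g 1 = 1" "act g (u + v) = act g u + act g v" "act g (u * v) = act g u * act g v"
  by (simp_all add: act_def)

lemma act_one [simp]: "act 1 u = u"
proof -
  have "(\<lambda>i. case i of GX \<Rightarrow> fgen GX | GY \<Rightarrow> fgen GY + fconst (to_ac (entry (1 :: 'a unip))) * fgen GX) = fgen"
    by (rule ext) (simp add: fconst_simps split: gen.split)
  then show ?thesis
    unfolding act_def by (simp only: free_lift_fgen_id)
qed

lemma act_act [simp]: "act g (act h u) = act (g * h) u"
  unfolding act_def free_lift_comp
  by (rule arg_cong[where f = "\<lambda>\<phi>. free_lift \<phi> u"], rule ext)
     (simp add: fconst_simps algebra_simps split: gen.split)

section \<open>The smash product\<close>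

text \<open>
  An element is a finitely supported family of coefficients, \<open>F\<close> standing for the sum
  of \<open>F g\<cdot>g\<close> over the group, multiplied by \<open>(u\<cdot>g)(v\<cdot>h) = u (g.v)\<cdot>gh\<close>.
\<close>

typedef (overloaded) 'f smash = "UNIV :: ('f::field unip \<Rightarrow>\<^sub>0 'f free_alg) set"
  by auto

setup_lifting type_definition_smash

definition smash_mult ::
  "('f::field unip \<Rightarrow>\<^sub>0 'f free_alg) \<Rightarrow> ('f unip \<Rightarrow>\<^sub>0 'f free_alg) \<Rightarrow> ('f unip \<Rightarrow>\<^sub>0 'f free_alg)" where
  "smash_mult F G = (\<Sum>g\<in>Poly_Mapping.keys F. \<Sum>h\<in>Poly_Mapping.keys G.
     Poly_Mapping.single (g * h) (Poly_Mapping.lookup F g * act g (Poly_Mapping.lookup G h)))"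

lemma smash_mult_zero [simp]: "smash_mult 0 G = 0" "smash_mult F 0 = 0"
  by (simp_all add: smash_mult_def)

lemma smash_mult_add_left: "smash_mult (F + F') G = smash_mult F G + smash_mult F' G"
  unfolding smash_mult_def
  by (rule setsum_keys_plus_distrib)
     (simp_all add: distrib_right single_add sum.distrib)

lemma smash_mult_add_right: "smash_mult F (G + G') = smash_mult F G + smash_mult F G'"
  unfolding smash_mult_def sum.distrib[symmetric]
  by (rule sum.cong[OF refl], rule setsum_keys_plus_distrib)
     (simp_all add: distrib_left single_add)

lemma smash_mult_single [simp]:
  "smash_mult (Poly_Mapping.single g u) (Poly_Mapping.single h v) =
     Poly_Mapping.single (g * h) (u * act g v)"
  by (cases "u = 0"; cases "v = 0") (simp_all add: smash_mult_def)

lemma smash_mult_assoc: "smash_mult (smash_mult F G) K = smash_mult F (smash_mult G K)"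
proof (induction F rule: pm_induct)
  case (single g u)
  show ?case
  proof (induction G rule: pm_induct)
    case (single h v)
    show ?case
      by (induction K rule: pm_induct) (simp_all add: smash_mult_add_right mult.assoc)
  qed (simp_all add: smash_mult_add_left smash_mult_add_right)
qed (simp_all add: smash_mult_add_left)

lemma smash_mult_one_left: "smash_mult (Poly_Mapping.single 1 1) F = F"
  by (induction F rule: pm_induct) (simp_all add: smash_mult_add_right)

lemma smash_mult_one_right: "smash_mult F (Poly_Mapping.single 1 1) = F"
  by (induction F rule: pm_induct) (simp_all add: smash_mult_add_left)

instantiation smash :: (field) ring_1
begin

lift_definition zero_smash :: "'a smash" is 0 .
lift_definition one_smash :: "'a smash" is "Poly_Mapping.single 1 1" .
lift_definition plus_smash :: "'a smash \<Rightarrow> 'a smash \<Rightarrow> 'a smash" is "(+)" .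
lift_definition minus_smash :: "'a smash \<Rightarrow> 'a smash \<Rightarrow> 'a smash" is "(-)" .
lift_definition uminus_smash :: "'a smash \<Rightarrow> 'a smash" is uminus .
lift_definition times_smash :: "'a smash \<Rightarrow> 'a smash \<Rightarrow> 'a smash" is smash_mult .

instance
proof
  show "(0 :: 'a smash) \<noteq> 1"
    by transfer (metis lookup_single_eq lookup_zero zero_neq_one)
qed (transfer; simp add: smash_mult_assoc smash_mult_one_left smash_mult_one_right
       smash_mult_add_left smash_mult_add_right algebra_simps)+

end

definition smash_elt :: "'f::field free_alg \<Rightarrow> 'f unip \<Rightarrow> 'f smash" where
  "smash_elt u g = Abs_smash (Poly_Mapping.single g u)"

lemma smash_elt_mult: "smash_elt u g * smash_elt v h = smash_elt (u * act g v) (g * h)"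
  by (simp add: smash_elt_def times_smash.abs_eq)

definition sx :: "'f::field smash" where "sx = smash_elt (fgen GX) 1"
definition sy :: "'f::field smash" where "sy = smash_elt (fgen GY) 1"
definition sgrp :: "'f::field unip \<Rightarrow> 'f smash" where "sgrp g = smash_elt 1 g"
definition sconst :: "'f::field alg_closure \<Rightarrow> 'f smash" where "sconst c = smash_elt (fconst c) 1"

section \<open>The quotient algebra and its center\<close>

lemma ring_ring_of_type_algebra: "ring (ring_of_type_algebra :: 'a::ring_1 ring)"
proof -
  have "\<exists>y. x + y = 0" for x :: 'a
    using add.right_inverse by blast
  then show ?thesis
    unfolding ring_of_type_algebra_def using add.right_inverse
    by unfold_locales (auto simp: algebra_simps Units_def)
qed

definition smash_ring :: "'f::field smash ring" where
  "smash_ring = ring_of_type_algebra"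

definition H_ideal :: "'f::field smash set" where
  "H_ideal = Idl\<^bsub>smash_ring\<^esub> {sx * sy - sy * sx - sgrp (unip_elt 1)}"

definition H_ring :: "'f::field smash set ring" where
  "H_ring = smash_ring Quot H_ideal"

definition H_proj :: "'f::field smash \<Rightarrow> 'f smash set" where
  "H_proj u = H_ideal +>\<^bsub>smash_ring\<^esub> u"

definition center :: "('a, 'b) ring_scheme \<Rightarrow> 'a set" where
  "center R = {z \<in> carrier R. \<forall>h\<in>carrier R. z \<otimes>\<^bsub>R\<^esub> h = h \<otimes>\<^bsub>R\<^esub> z}"

definition center_ring :: "('a, 'b) ring_scheme \<Rightarrow> ('a, 'b) ring_scheme" where
  "center_ring R = R\<lparr>carrier := center R\<rparr>"

lemma ideal_H_ideal: "ideal H_ideal (smash_ring :: 'f::field smash ring)"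
proof -
  interpret ring "smash_ring :: 'f smash ring"
    unfolding smash_ring_def by (rule ring_ring_of_type_algebra)
  show ?thesis
    unfolding H_ideal_def
    by (rule genideal_ideal) (simp add: smash_ring_def ring_of_type_algebra_def)
qed

lemma ring_H_ring: "ring (H_ring :: 'f::field smash set ring)"
  unfolding H_ring_def by (rule ideal.quotient_is_ring[OF ideal_H_ideal])

lemma H_proj_hom: "H_proj \<in> ring_hom smash_ring (H_ring :: 'f::field smash set ring)"
  unfolding H_ring_def H_proj_def by (rule ideal.rcos_ring_hom[OF ideal_H_ideal])

section \<open>The elements of the center\<close>

definition A_elt :: "'f::field smash set" where
  "A_elt = H_proj (sx ^ 2 - 2 * sgrp (unip_elt 1) + 2)"

definition B_elt :: "nat \<Rightarrow> 'f::field smash set" where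
  "B_elt p = H_proj (sx ^ p)"

text \<open>
  The span over the prime field: \<^const>\<open>of_int\<close> maps the integers onto the prime field.
\<close>

definition Xi :: "'f::field \<Rightarrow> nat \<Rightarrow> 'f set" where
  "Xi \<xi> r = {\<Sum>i = 1..<r. of_int (c i) * \<xi> ^ i |c. True}"

text \<open>The list \<open>zs\<close> prescribes the order of the outer product.\<close>

definition C_elt :: "nat \<Rightarrow> 'f::field list \<Rightarrow> 'f smash set" where
  "C_elt p zs = H_proj
     (\<Prod>\<zeta>\<leftarrow>zs. \<Prod>a\<leftarrow>[1..<p + 1]. sy - sconst (to_ac (\<zeta> + of_nat a)) * sx)"

section \<open>The commutative presentation\<close>

datatype var = VA | VB | VC

text \<open>The polynomial ring in three variables is the monoid algebra of the exponent vectors.\<close>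

type_synonym 'f poly3 = "(var \<Rightarrow>\<^sub>0 nat) \<Rightarrow>\<^sub>0 'f alg_closure"

definition pvar :: "var \<Rightarrow> 'f::field poly3" where
  "pvar v = Poly_Mapping.single (Poly_Mapping.single v 1) 1"

definition pconst :: "'f::field alg_closure \<Rightarrow> 'f poly3" where
  "pconst c = Poly_Mapping.single 0 c"

definition poly3_ring :: "'f::field poly3 ring" where
  "poly3_ring = ring_of_type_algebra"

definition rel_ideal :: "nat \<Rightarrow> 'f::field poly3 set" where
  "rel_ideal p = Idl\<^bsub>poly3_ring\<^esub> {pvar VA ^ p - pvar VB ^ 2}"

definition pproj :: "nat \<Rightarrow> 'f::field poly3 \<Rightarrow> 'f poly3 set" where
  "pproj p f = rel_ideal p +>\<^bsub>poly3_ring\<^esub> f"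

end

theory Submission
  imports Defs
begin

text \<open>
  Moving all group elements to the left of \<open>y\<close> presents \<open>H\<close> as an Ore extension \<open>R[y; \<delta>]\<close> of the
  commutative ring \<open>R = kE[x]\<close>, where \<open>\<delta> x = - g\<^sub>1\<close> and \<open>\<delta> g = - a x g\<close> for the matrix \<open>g\<close> with
  entry \<open>a\<close>. Since \<open>y - a x\<close> is the conjugate of \<open>y\<close> by the matrix with entry \<open>- a\<close>, the inner products
  telescope: they are conjugates of \<open>w ^ p\<close> for \<open>w = g\<^sub>1\<^sup>-\<^sup>1 y\<close>. As \<open>x w - w x = 1\<close>, the element \<open>w ^ p\<close>
  commutes with \<open>x\<close>, \<open>g\<^sub>1\<close> and \<open>y\<close>, so that \<open>E\<close> permutes the pairwise commuting factors of \<open>C\<close>.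

  Conversely, \<open>\<delta>\<^sup>j g\<close> is \<open>g\<close> times a polynomial of degree \<open>j\<close> in the entry of \<open>g\<close>, with leading
  coefficient \<open>(- x)\<^sup>j\<close>. Evaluating at all \<open>q\<close> entries shows that a central element of degree less
  than \<open>q\<close> in \<open>y\<close> lies in the kernel of \<open>\<delta>\<close>, and \<open>C\<close> is monic of degree \<open>q\<close>, so division by \<open>C\<close>
  reduces the center to this kernel. An element of the kernel has scalar leading coefficient in \<open>x\<close>, and
  its degree is even or at least \<open>p\<close>; these are the degrees of the monomials \<open>A\<^sup>i B\<^sup>e\<close> with \<open>e \<le> 1\<close>,
  which are monic in \<open>x\<close>.
\<close>

section \<open>The Ore extension\<close>

type_synonym 'f grp_alg = "'f \<Rightarrow>\<^sub>0 'f alg_closure"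
type_synonym 'f base = "'f grp_alg poly"

text \<open>A basis element of kE is named by its matrix entry, so the group law is addition of
  entries. Scaling by an additive degree, here the entry, is a derivation.\<close>

definition gder :: "'f::field grp_alg \<Rightarrow> 'f grp_alg" where
  "gder u = Poly_Mapping.mapp (\<lambda>a c. to_ac a * c) u"

lemma lookup_gder [simp]: "Poly_Mapping.lookup (gder u) a = to_ac a * Poly_Mapping.lookup u a"
  by (simp add: gder_def lookup_mapp when_def in_keys_iff)

lemma gder_0 [simp]: "gder 0 = 0"
  by (rule poly_mapping_eqI) simp

lemma gder_add [simp]: "gder (u + v) = gder u + gder v"
  by (rule poly_mapping_eqI) (simp add: lookup_add algebra_simps)

lemma gder_single [simp]:
  "gder (Poly_Mapping.single a c) = Poly_Mapping.single a (to_ac a * c)"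
  by (rule poly_mapping_eqI) (simp add: lookup_single when_def)

lemma gder_mult: "gder (u * v) = gder u * v + u * gder v"
proof (induction u rule: pm_induct)
  case (single a c)
  show ?case
    by (induction v rule: pm_induct)
      (simp_all add: mult_single algebra_simps flip: single_add)
qed (simp_all add: algebra_simps)

text \<open>The formal derivative d/dx, over a coefficient ring that may have zero divisors; in kE
  one has \<open>(g_1 - 1)^p = 0\<close>.\<close>

lift_definition xder :: "'a::comm_semiring_1 poly \<Rightarrow> 'a poly"
  is "\<lambda>f n. of_nat (Suc n) * f (Suc n)"
proof -
  fix f :: "nat \<Rightarrow> 'a" assume "\<forall>\<^sub>\<infinity>n. f n = 0"
  then have "\<forall>\<^sub>\<infinity>n. f (Suc n) = 0" by (rule MOST_SucI)
  then show "\<forall>\<^sub>\<infinity>n. of_nat (Suc n) * f (Suc n) = 0" by (rule MOST_mono) simp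
qed

declare xder.rep_eq [simp]

lemma xder_0 [simp]: "xder 0 = 0"
  by (rule poly_eqI) simp

lemma xder_add [simp]: "xder (f + g) = xder f + xder g"
  by (rule poly_eqI) (simp add: algebra_simps)

lemma xder_smult [simp]: "xder (smult c f) = smult c (xder f)"
  by (rule poly_eqI) (simp add: algebra_simps)

lemma xder_pCons: "xder (pCons c f) = f + pCons 0 (xder f)"
  by (rule poly_eqI) (simp add: coeff_pCons algebra_simps split: nat.split)

lemma xder_mult: "xder (f * g) = xder f * g + f * xder g"
proof (induction f)
  case (pCons c f)
  then show ?case by (simp add: xder_pCons algebra_simps)
qed simp

lemma map_poly_gder_add: "map_poly gder (f + g) = map_poly gder f + map_poly gder g"
  by (rule poly_eqI) (simp add: coeff_map_poly)

lemma map_poly_gder_smult: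
  "map_poly gder (smult c f) = smult (gder c) f + smult c (map_poly gder f)"
  by (rule poly_eqI) (simp add: coeff_map_poly gder_mult)

lemma map_poly_gder_mult:
  "map_poly gder (f * g) = map_poly gder f * g + f * map_poly gder g"
proof (induction f)
  case (pCons c f)
  then show ?case
    by (simp add: map_poly_pCons map_poly_gder_add map_poly_gder_smult algebra_simps)
qed simp

text \<open>The combination \<open>- g_1 d/dx - x gder\<close> of two derivations. Its values on
  \<open>x\<close>, on scalars and on group elements are those of the commutator with
  \<open>y\<close> in H.\<close>

definition delta :: "'f::field base \<Rightarrow> 'f base" where
  "delta f = - smult (Poly_Mapping.single 1 1) (xder f) - pCons 0 (map_poly gder f)"

lemma delta_0 [simp]: "delta 0 = 0"
  by (simp add: delta_def)

lemma delta_add [simp]: "delta (f + g) = delta f + delta g"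
  by (simp add: delta_def map_poly_gder_add algebra_simps smult_add_right)

lemma delta_mult: "delta (f * g) = delta f * g + f * delta g"
  by (simp add: delta_def map_poly_gder_mult xder_mult algebra_simps smult_add_right)

lemma delta_1 [simp]: "delta 1 = 0"
  using delta_mult[of 1 1] by simp

lemma delta_uminus [simp]: "delta (- f) = - delta f"
  using delta_add[of f "- f"] by (simp add: eq_neg_iff_add_eq_0 add.commute)

lemma delta_diff [simp]: "delta (f - g) = delta f - delta g"
  using delta_add[of f "- g"] by simp

section \<open>Skew polynomials in y over the base ring\<close>

text \<open>Coefficients stand to the left of the powers of \<open>y\<close>, and \<open>ydel\<close> is left multiplication by \<open>y\<close>.\<close>

definition ydel :: "'f::field base poly \<Rightarrow> 'f base poly" where
  "ydel P = pCons 0 P + map_poly delta P"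

lemma ydel_0 [simp]: "ydel 0 = 0"
  by (simp add: ydel_def)

lemma coeff_ydel: "coeff (ydel P) n = (case n of 0 \<Rightarrow> 0 | Suc m \<Rightarrow> coeff P m) + delta (coeff P n)"
  by (simp add: ydel_def coeff_map_poly coeff_pCons split: nat.split)

lemma ydel_add [simp]: "ydel (P + Q) = ydel P + ydel Q"
  by (rule poly_eqI) (simp add: coeff_ydel split: nat.split)

lemma ydel_smult: "ydel (smult r P) = smult r (ydel P) + smult (delta r) P"
  by (rule poly_eqI) (simp add: coeff_ydel delta_mult algebra_simps split: nat.split)

lemma ydel_pCons: "ydel (pCons r P) = pCons (delta r) (ydel P + [:r:])"
  by (rule poly_eqI) (simp add: coeff_ydel coeff_pCons split: nat.split)

lemma ydel_monom: "ydel (monom 1 n) = monom 1 (Suc n)"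
  by (rule poly_eqI) (simp add: coeff_ydel split: nat.split)

text \<open>\<open>pCons r P\<close> stands for \<open>r + P y\<close>, so the recursion is
  \<open>(r + P y) Q = r Q + P (y Q)\<close>, with \<open>ydel\<close> supplying
  \<open>y Q\<close>.\<close>

definition ore_mult :: "'f::field base poly \<Rightarrow> 'f base poly \<Rightarrow> 'f base poly" where
  "ore_mult P = fold_coeffs (\<lambda>r F Q. smult r Q + F (ydel Q)) P (\<lambda>_. 0)"

lemma ore_mult_0 [simp]: "ore_mult 0 Q = 0"
  by (simp add: ore_mult_def)

lemma ore_mult_pCons [simp]: "ore_mult (pCons r P) Q = smult r Q + ore_mult P (ydel Q)"
  by (cases "r = 0"; cases "P = 0") (simp_all add: ore_mult_def)

lemma ore_mult_add_left: "ore_mult (P + P') Q = ore_mult P Q + ore_mult P' Q"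
  by (induction P P' arbitrary: Q rule: poly_induct2) (simp_all add: smult_add_left)

lemma ore_mult_add_right: "ore_mult P (Q + Q') = ore_mult P Q + ore_mult P Q'"
  by (induction P arbitrary: Q Q') (simp_all add: smult_add_right)

lemma ore_mult_0_right [simp]: "ore_mult P 0 = 0"
  by (induction P) simp_all

lemma ore_mult_smult_left: "ore_mult (smult r P) Q = smult r (ore_mult P Q)"
  by (induction P arbitrary: Q) (simp_all add: smult_add_right)

text \<open>Associativity with \<open>y\<close> as the left factor. It is where the Leibniz rule for
  \<open>delta\<close> enters, and full associativity follows from it by induction on the left
  factor.\<close>

lemma ydel_ore_mult: "ydel (ore_mult P Q) = ore_mult (ydel P) Q"
  by (induction P arbitrary: Q) (simp_all add: ydel_smult ydel_pCons ore_mult_add_left)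

lemma ore_mult_assoc: "ore_mult (ore_mult P Q) S = ore_mult P (ore_mult Q S)"
  by (induction P arbitrary: Q)
    (simp_all add: ore_mult_add_left ore_mult_smult_left ydel_ore_mult)

text \<open>Coefficients stand on the left, so multiplying by a power of \<open>y\<close> on the
  right is a mere shift. The case \<open>n = 0\<close> is the right unit law.\<close>

lemma ore_mult_monom_right: "ore_mult P (monom 1 n) = monom 1 n * P"
proof (induction P arbitrary: n)
  case (pCons r P)
  then show ?case
    by (simp add: ydel_monom) (simp add: monom_Suc)
qed simp

lemma ore_mult_1_left: "ore_mult 1 Q = Q"
  using ore_mult_pCons[of 1 0 Q] by (simp del: ore_mult_pCons flip: one_pCons)

typedef (overloaded) 'f ore = "UNIV :: 'f::field base poly set"
  morphisms ypoly Ore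
  by auto

setup_lifting type_definition_ore

instantiation ore :: (field) ring_1
begin

lift_definition zero_ore :: "'a ore" is 0 .
lift_definition one_ore :: "'a ore" is 1 .
lift_definition plus_ore :: "'a ore \<Rightarrow> 'a ore \<Rightarrow> 'a ore" is "(+)" .
lift_definition minus_ore :: "'a ore \<Rightarrow> 'a ore \<Rightarrow> 'a ore" is "(-)" .
lift_definition uminus_ore :: "'a ore \<Rightarrow> 'a ore" is uminus .
lift_definition times_ore :: "'a ore \<Rightarrow> 'a ore \<Rightarrow> 'a ore" is ore_mult .

instance
proof
  show "a * 1 = a" for a :: "'a ore"
    by transfer (metis ore_mult_monom_right monom_eq_1 mult_1)
  show "1 * a = a" for a :: "'a ore"
    by transfer (metis ore_mult_1_left)
qed (transfer; simp add: ore_mult_assoc ore_mult_add_left ore_mult_add_right algebra_simps)+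

end

section \<open>Generators of the base ring and of the Ore extension\<close>

abbreviation bX :: "'f::field base" where "bX \<equiv> [:0, 1:]"

definition bG :: "'f::field \<Rightarrow> 'f base" where "bG a = [:Poly_Mapping.single a 1:]"

definition bK :: "'f::field alg_closure \<Rightarrow> 'f base" where "bK c = [:Poly_Mapping.single 0 c:]"

lemma bK_simps [simp]: "bK 0 = 0" "bK 1 = 1" "bK (c + d) = bK c + bK d" "bK (c * d) = bK c * bK d"
  "bK (- c) = - bK c"
  by (simp_all add: bK_def single_add mult_single one_pCons single_uminus mult.commute)

lemma bG_simps: "bG 0 = 1" "bG (a + b) = bG a * bG b"
  by (simp_all add: bG_def mult_single one_pCons add.commute)

lemma bG_inverse: "bG a * bG (- a) = 1"
  by (simp add: bG_simps flip: bG_simps(2))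

text \<open>Scalars, group elements and \<open>x\<close> generate the base ring, so commutation and
  Leibniz-type identities need to be checked on them only.\<close>

lemma base_induct [case_names const grp var add mult]:
  assumes "\<And>c. P (bK c)" "\<And>a. P (bG a)" "P bX"
    "\<And>r s. P r \<Longrightarrow> P s \<Longrightarrow> P (r + s)" "\<And>r s. P r \<Longrightarrow> P s \<Longrightarrow> P (r * s)"
  shows "P (r :: 'f::field base)"
proof (induction r)
  case 0
  show ?case using assms(1)[of 0] by simp
next
  case (pCons u r)
  have "P [:u:]"
  proof (induction u rule: pm_induct)
    case zero
    show ?case using assms(1)[of 0] by simp
  next
    case (single a c)
    have "[:Poly_Mapping.single a c:] = bK c * bG a"
      by (simp add: bK_def bG_def mult_single)
    then show ?case using assms(1,2,5) by metis
  next
    case (add u v)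
    then have "P ([:u:] + [:v:])" by (rule assms(4))
    then show ?case by simp
  qed
  moreover have "pCons u r = [:u:] + bX * r"
    by simp
  ultimately show ?case
    using assms(3,4,5) pCons.IH by metis
qed

lemma delta_bX [simp]: "delta bX = - bG (1 :: 'f::field)"
proof -
  have "xder bX = (1 :: 'f base)" "map_poly gder (bX :: 'f base) = 0"
    by (simp_all add: xder_pCons map_poly_pCons one_pCons)
      (metis gder_single single_one mult_zero_left single_zero to_ac_0)
  then show ?thesis by (simp add: delta_def bG_def one_pCons)
qed

lemma xder_const [simp]: "xder [:c:] = 0"
  by (simp add: xder_pCons)

lemma delta_bG: "delta (bG a) = - (bK (to_ac a) * bX * bG a)"
  by (simp add: delta_def bG_def bK_def map_poly_pCons mult_single)

lemma delta_bK [simp]: "delta (bK c) = 0"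
  by (simp add: delta_def bK_def map_poly_pCons)

definition ybase :: "'f::field base \<Rightarrow> 'f ore" where "ybase r = Ore [:r:]"

definition oY :: "'f::field ore" where "oY = Ore [:0, 1:]"

lemma ypoly_simps [simp]: "ypoly 0 = 0" "ypoly 1 = 1" "ypoly (u + v) = ypoly u + ypoly v"
  "ypoly (u - v) = ypoly u - ypoly v" "ypoly (- u) = - ypoly u" "ypoly (ybase r) = [:r:]"
  "ypoly oY = [:0, 1:]"
  by (simp_all add: zero_ore.rep_eq one_ore.rep_eq plus_ore.rep_eq minus_ore.rep_eq
      uminus_ore.rep_eq ybase_def oY_def Ore_inverse)

lemma ypoly_mult: "ypoly (u * v) = ore_mult (ypoly u) (ypoly v)"
  by (rule times_ore.rep_eq)

lemma ypoly_inject_iff: "u = v \<longleftrightarrow> ypoly u = ypoly v"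
  by (simp add: ypoly_inject)

abbreviation oX :: "'f::field ore" where "oX \<equiv> ybase bX"

abbreviation oG :: "'f::field \<Rightarrow> 'f ore" where "oG a \<equiv> ybase (bG a)"

abbreviation oK :: "'f::field alg_closure \<Rightarrow> 'f ore" where "oK c \<equiv> ybase (bK c)"

lemma ybase_simps [simp]: "ybase 0 = 0" "ybase 1 = 1" "ybase (r + s) = ybase r + ybase s"
  "ybase (r * s) = ybase r * ybase s" "ybase (- r) = - ybase r" "ybase (r - s) = ybase r - ybase s"
  by (simp_all add: ypoly_inject_iff ypoly_mult one_pCons)

lemma ybase_power [simp]: "ybase (r ^ n) = ybase r ^ n"
  by (induction n) simp_all

lemma ybase_commute: "ybase r * ybase s = ybase s * ybase r"
  by (metis mult.commute ybase_simps(4))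

lemma oY_ybase: "oY * ybase r = ybase r * oY + ybase (delta r)"
  by (simp add: ypoly_inject_iff ypoly_mult ydel_pCons)

lemma ypoly_ybase_mult [simp]: "ypoly (ybase r * u) = smult r (ypoly u)"
  by (simp add: ypoly_mult)

lemma ypoly_oY_mult [simp]: "ypoly (oY * u) = ydel (ypoly u)"
  by (simp add: ypoly_mult)

lemma ypoly_mult_oY [simp]: "ypoly (u * oY) = pCons 0 (ypoly u)"
proof -
  have "[:0, 1:] = (monom 1 1 :: 'a base poly)"
    by (simp add: monom_Suc monom_0 del: monom_eq_1)
  then show ?thesis
    by (simp only: ypoly_mult ypoly_simps ore_mult_monom_right) (simp add: monom_Suc)
qed

lemma ore_induct [case_names base add multY]:
  assumes "\<And>r. P (ybase r)" "\<And>u v. P u \<Longrightarrow> P v \<Longrightarrow> P (u + v)" "\<And>u. P u \<Longrightarrow> P (u * oY)"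
  shows "P (u :: 'f::field ore)"
proof -
  have "P (Ore p)" for p
  proof (induction p)
    case 0
    show ?case using assms(1)[of 0] by (simp add: zero_ore_def)
  next
    case (pCons r p)
    have "Ore (pCons r p) = ybase r + Ore p * oY"
      by (simp add: ypoly_inject_iff Ore_inverse)
    then show ?case using assms pCons.IH by metis
  qed
  then show ?thesis by (metis ypoly_inverse)
qed

lemma ore_centralI:
  assumes "\<And>c. z * oK c = oK c * z" "\<And>a. z * oG a = oG a * z" "z * oX = oX * z" "z * oY = oY * z"
  shows "z * u = u * z"
proof (induction u rule: ore_induct)
  case (base r)
  show ?case
  proof (induction r rule: base_induct)
    case (mult r s)
    then show ?case by (simp, metis mult.assoc)
  qed (simp_all add: assms algebra_simps)
next
  case (multY u)
  then show ?case by (metis mult.assoc assms(4))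
qed (simp_all add: algebra_simps)

section \<open>Leading and constant coefficients of products\<close>

lemma ore_mult_top:
  assumes "degree P \<le> m" "degree Q \<le> n"
  shows "degree (ore_mult P Q) \<le> m + n \<and> coeff (ore_mult P Q) (m + n) = coeff P m * coeff Q n"
  using assms
proof (induction P arbitrary: Q m n)
  case (pCons r P)
  show ?case
  proof (cases m)
    case 0
    with pCons have "P = 0" by (auto split: if_splits)
    with 0 pCons show ?thesis
      using degree_smult_le[of r Q] by simp
  next
    case (Suc k)
    \<comment> \<open>Left multiplication by \<open>y\<close> raises the degree bound by one and
      keeps the top coefficient, since \<open>delta\<close> does not move coefficients to another
      degree.\<close>
    have deg: "degree (ydel Q) \<le> Suc n"
      using pCons.prems(2) by (intro degree_le) (auto simp: coeff_ydel coeff_eq_0 split: nat.split)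
    have top: "coeff (ydel Q) (Suc n) = coeff Q n"
      using pCons.prems(2) by (simp add: coeff_ydel coeff_eq_0)
    have "degree P \<le> k"
      using pCons.prems(1) Suc by (auto split: if_splits)
    from pCons.IH[OF this deg] top pCons.prems(2) Suc
    show ?thesis
      using degree_smult_le[of r Q]
      by (auto intro!: degree_add_le simp: coeff_eq_0)
  qed
qed simp

definition ydeg :: "'f::field ore \<Rightarrow> nat" where "ydeg u = degree (ypoly u)"

definition ycoeff :: "'f::field ore \<Rightarrow> nat \<Rightarrow> 'f base" where "ycoeff u = coeff (ypoly u)"

text \<open>Upper bounds replace exact degrees because the base has zero divisors and a product of
  leading coefficients may vanish.\<close>

lemma ydeg_mult_le: "ydeg u \<le> m \<Longrightarrow> ydeg v \<le> n \<Longrightarrow> ydeg (u * v) \<le> m + n"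
  and ycoeff_mult_top: "ydeg u \<le> m \<Longrightarrow> ydeg v \<le> n \<Longrightarrow> ycoeff (u * v) (m + n) = ycoeff u m * ycoeff v n"
  using ore_mult_top[of "ypoly u" m "ypoly v" n] by (simp_all add: ydeg_def ycoeff_def ypoly_mult)

text \<open>Moving \<open>y^j\<close> to the right past \<open>r\<close> leaves
  \<open>delta^j r\<close> as the term free of \<open>y\<close>. Terms of \<open>Q\<close> with a
  positive power of \<open>y\<close> on the right never reach the constant coefficient.\<close>

lemma coeff_0_ore_mult:
  assumes "degree P \<le> n"
  shows "coeff (ore_mult P Q) 0 = (\<Sum>j\<le>n. coeff P j * (delta ^^ j) (coeff Q 0))"
  using assms
proof (induction P arbitrary: Q n)
  case (pCons r P)
  show ?case
  proof (cases n)
    case 0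
    with pCons have "P = 0" by (auto split: if_splits)
    with 0 pCons show ?thesis by simp
  next
    case (Suc k)
    have "degree P \<le> k"
      using pCons.prems(1) Suc by (auto split: if_splits)
    from pCons.IH[OF this, of "ydel Q"] show ?thesis
      by (simp add: Suc sum.atMost_Suc_shift coeff_ydel funpow_Suc_right
          del: funpow.simps sum.atMost_Suc)
  qed
qed simp

text \<open>\<open>z y\<close> shifts the coefficients of \<open>z\<close>, while \<open>y z\<close>
  shifts them and adds \<open>delta\<close> of each one.\<close>

lemma delta_coeff_of_commute:
  assumes "z * oY = oY * z"
  shows "delta (ycoeff z n) = 0"
proof -
  have "pCons 0 (ypoly z) = ydel (ypoly z)"
    using assms by (metis ypoly_mult_oY ypoly_oY_mult)
  then have "coeff (pCons 0 (ypoly z)) n = coeff (ydel (ypoly z)) n" by simp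
  then show ?thesis by (simp add: coeff_ydel ycoeff_def coeff_pCons split: nat.splits)
qed

section \<open>Central elements of low degree in y\<close>

lemma delta_poly_bK: "delta (poly p (bK c)) = poly (map_poly delta p) (bK c)"
  by (induction p) (simp_all add: map_poly_pCons delta_mult)

text \<open>The entry of the group element is treated as the variable of a polynomial over the base;
  one polynomial per \<open>j\<close> serves all group elements at once.\<close>

lemma delta_funpow_bG:
  "\<exists>p :: 'f::field base poly. degree p \<le> j \<and> coeff p j = (- bX) ^ j \<and>
     (\<forall>a. (delta ^^ j) (bG a) = bG a * poly p (bK (to_ac a)))"
proof (induction j)
  case 0
  show ?case by (rule exI[of _ 1]) simp
next
  case (Suc j)
  then obtain p :: "'f base poly" where p: "degree p \<le> j" "coeff p j = (- bX) ^ j"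
    "\<And>a. (delta ^^ j) (bG a) = bG a * poly p (bK (to_ac a))"
    by blast
  \<comment> \<open>From \<open>delta (g p(a)) = g ((delta p)(a) - a x p(a))\<close>, where
    multiplication by the entry \<open>a\<close> becomes the shift \<open>pCons 0\<close>.\<close>
  define p' where "p' = map_poly delta p - pCons 0 (smult bX p)"
  have "degree p' \<le> Suc j"
    unfolding p'_def using p(1)
    by (intro degree_le) (auto simp: coeff_map_poly coeff_pCons coeff_eq_0 split: nat.split)
  moreover have "coeff p' (Suc j) = (- bX) ^ Suc j"
  proof -
    have "coeff p' (Suc j) = - (bX * coeff p j)"
      using p(1) by (simp add: p'_def coeff_map_poly coeff_eq_0 del: mult_pCons_left mult_pCons_right)
    then show ?thesis by (simp only: p(2) power_Suc minus_mult_left)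
  qed
  moreover have "(delta ^^ Suc j) (bG a) = bG a * poly p' (bK (to_ac a))" for a
    by (simp add: p p'_def delta_mult delta_bG delta_poly_bK algebra_simps
        del: mult_pCons_left mult_pCons_right)
  ultimately show ?case by blast
qed

text \<open>Over a ring with zero divisors roots do not bound the degree. But the roots are scalars,
  so \<open>F\<close> splits into component polynomials over the field k, each with the q distinct
  roots \<open>to_ac a\<close>.\<close>

lemma poly_eq_0_of_bK_roots:
  fixes F :: "'f::{field,finite} base poly"
  assumes "degree F < CARD('f)" "\<And>a :: 'f. poly F (bK (to_ac a)) = 0"
  shows "F = 0"
proof -
  have "Poly_Mapping.lookup (coeff (coeff F t) i) b = 0" for t i b
  proof -
    \<comment> \<open>The k-linear functional reading off the coefficient of \<open>x^i\<close>
      times the group element with entry \<open>b\<close>.\<close>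
    define h where "h = (\<lambda>r :: 'f base. Poly_Mapping.lookup (coeff r i) b)"
    have h0: "h 0 = 0" and h_add: "h (r + s) = h r + h s" for r s
      by (simp_all add: h_def lookup_add)
    have h_bK: "h (bK c * r) = c * h r" for r c
    proof -
      have "Poly_Mapping.lookup (Poly_Mapping.single 0 c * u) b = c * Poly_Mapping.lookup u b"
        for u :: "'f grp_alg"
        by (induction u rule: pm_induct)
          (simp_all add: mult_single lookup_single lookup_add algebra_simps when_def)
      then show ?thesis by (simp add: h_def bK_def)
    qed
    have "poly (map_poly h F) c = h (poly F (bK c))" for c
      by (induction F) (simp_all add: h0 h_add map_poly_pCons h_bK)
    then have "range (to_ac :: 'f \<Rightarrow> _) \<subseteq> {c. poly (map_poly h F) c = 0}"
      using assms(2) h0 by auto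
    then have "CARD('f) \<le> card {c. poly (map_poly h F) c = 0}" if "map_poly h F \<noteq> 0"
      using card_mono[OF poly_roots_finite[OF that], of "range (to_ac :: 'f \<Rightarrow> _)"]
      by (simp add: card_image inj_to_ac)
    moreover have "degree (map_poly h F) < CARD('f)"
      by (rule le_less_trans[OF degree_le assms(1)]) (simp add: coeff_map_poly h0 coeff_eq_0)
    ultimately have "map_poly h F = 0"
      using card_poly_roots_bound[of "map_poly h F"] by fastforce
    then have "h (coeff F t) = 0"
      using coeff_map_poly[of h F t, OF h0] by simp
    then show ?thesis by (simp only: h_def)
  qed
  then show ?thesis by (intro poly_eqI poly_mapping_eqI) simp
qed

text \<open>Although the base has zero divisors, \<open>x\<close> is not one of them: multiplying by
  it shifts coefficients.\<close>

lemma bX_power_cancel: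
  assumes "r * (- bX) ^ n = (0 :: 'f::field base)"
  shows "r = 0"
  using assms
proof (induction n)
  case (Suc n)
  have "pCons 0 (r * (- bX) ^ n) = - (r * (- bX) ^ Suc n)"
    by (simp add: algebra_simps)
  with Suc.prems have "pCons 0 (r * (- bX) ^ n) = 0" by simp
  then show ?case by (intro Suc.IH) simp
qed simp

lemma central_low_degree:
  fixes z :: "'f::{field,finite} ore"
  assumes "\<And>a. z * oG a = oG a * z" "ydeg z < CARD('f)"
  shows "ydeg z = 0"
proof (rule ccontr)
  define n where "n = ydeg z"
  assume "ydeg z \<noteq> 0"
  then have n: "n > 0" by (simp add: n_def)
  have "\<forall>j. \<exists>p :: 'f base poly. degree p \<le> j \<and> coeff p j = (- bX) ^ j \<and>
     (\<forall>a. (delta ^^ j) (bG a) = bG a * poly p (bK (to_ac a)))"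
    using delta_funpow_bG by blast
  then obtain p :: "nat \<Rightarrow> 'f base poly" where p: "\<And>j. degree (p j) \<le> j"
    "\<And>j. coeff (p j) j = (- bX) ^ j"
    "\<And>j a. (delta ^^ j) (bG a) = bG a * poly (p j) (bK (to_ac a))"
    by metis
  \<comment> \<open>Its value at the entry \<open>a\<close> is the constant coefficient of
    \<open>z g - g z\<close> with the factor \<open>g\<close> removed.\<close>
  define F where "F = (\<Sum>j=1..n. smult (ycoeff z j) (p j))"
  have degF: "degree F \<le> n" unfolding F_def
    by (intro degree_sum_le order.trans[OF degree_smult_le] order.trans[OF p(1)]) simp_all
  have "poly F (bK (to_ac a)) = 0" for a
  proof -
    have "coeff (ypoly (z * oG a)) 0 = coeff (ypoly (oG a * z)) 0"
      using assms(1) by simp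
    moreover have "coeff (ypoly (z * oG a)) 0 = (\<Sum>j\<le>n. ycoeff z j * (delta ^^ j) (bG a))"
      using coeff_0_ore_mult[of "ypoly z" n "[:bG a:]"]
      by (simp add: ypoly_mult[of z] n_def ydeg_def ycoeff_def)
    moreover have "coeff (ypoly (oG a * z)) 0 = bG a * ycoeff z 0"
      by (simp add: ycoeff_def)
    ultimately have "(\<Sum>j\<le>n. ycoeff z j * (delta ^^ j) (bG a)) = bG a * ycoeff z 0"
      by simp
    \<comment> \<open>The term for \<open>j = 0\<close> equals the right-hand side by commutativity
      of the base, and cancels.\<close>
    moreover have "{..n} = insert 0 {1..n}" by auto
    ultimately have "(\<Sum>j=1..n. ycoeff z j * (delta ^^ j) (bG a)) = 0"
      by (simp add: algebra_simps)
    then have "bG a * poly F (bK (to_ac a)) = 0"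
      by (simp add: F_def poly_sum sum_distrib_left p(3) algebra_simps)
    then have "(bG a * bG (- a)) * poly F (bK (to_ac a)) = 0"
      by (metis mult.assoc mult.commute mult_zero_left)
    then show ?thesis by (simp add: bG_inverse)
  qed
  with degF assms(2) have "F = 0"
    by (intro poly_eq_0_of_bK_roots) (simp_all add: n_def)
  \<comment> \<open>\<open>p j\<close> has degree at most \<open>j\<close>, so only
    \<open>j = n\<close> contributes to degree \<open>n\<close>.\<close>
  moreover have "coeff F n = ycoeff z n * (- bX) ^ n"
  proof -
    have "coeff F n = (\<Sum>j=1..n. ycoeff z j * coeff (p j) n)"
      by (simp add: F_def coeff_sum)
    also have "\<dots> = (\<Sum>j\<in>{n}. ycoeff z j * coeff (p j) n)"
    proof (intro sum.mono_neutral_right ballI)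
      fix j assume "j \<in> {1..n} - {n}"
      then show "ycoeff z j * coeff (p j) n = 0"
        using p(1)[of j] by (simp add: coeff_eq_0)
    qed (use n in auto)
    finally show ?thesis by (simp add: p(2))
  qed
  ultimately have "ycoeff z n = 0"
    using bX_power_cancel[of "ycoeff z n" n] by simp
  then show False
    using n by (simp add: n_def ycoeff_def ydeg_def)
qed

section \<open>The span of the powers of a generator\<close>

lemma CHAR_eq_of_CARD_prime_power:
  assumes "prime p" "CARD('f::{field,finite}) = p ^ r"
  shows "CHAR('f) = p"
proof -
  \<comment> \<open>Translation by 1 permutes the field; comparing the two sums gives
    \<open>q * 1 = 0\<close>.\<close>
  have "(\<Sum>x\<in>UNIV. x) = (\<Sum>x\<in>UNIV. x + 1 :: 'f)"
    by (rule sum.reindex_bij_witness[of _ "\<lambda>x. x + 1" "\<lambda>x. x - 1"]) simp_all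
  then have "of_nat CARD('f) = (0 :: 'f)"
    by (simp add: sum.distrib)
  then have "CHAR('f) dvd p ^ r"
    using assms(2) of_nat_eq_0_iff_char_dvd by metis
  moreover have "prime CHAR('f)"
    by (simp add: finite_imp_CHAR_pos prime_CHAR_semidom)
  ultimately show ?thesis
    using assms(1) prime_dvd_power primes_dvd_imp_eq by blast
qed

lemma of_int_eq_of_nat_CHAR:
  assumes "CHAR('f::ring_1) > 0"
  shows "\<exists>k<CHAR('f). (of_int m :: 'f) = of_nat k"
proof -
  define p where "p = int CHAR('f)"
  have p: "p > 0" using assms by (simp add: p_def)
  have "(of_int m :: 'f) = of_int (p * (m div p) + m mod p)" by simp
  also have "\<dots> = of_int p * of_int (m div p) + of_int (m mod p)"
    by (simp only: of_int_add of_int_mult)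
  also have "\<dots> = of_nat (nat (m mod p))"
    using p by (simp add: p_def)
  finally have "(of_int m :: 'f) = of_nat (nat (m mod p))" .
  moreover have "nat (m mod p) < CHAR('f)"
    using p by (simp add: p_def nat_less_iff)
  ultimately show ?thesis by blast
qed

section \<open>Spans of consecutive powers over the prime field\<close>

definition pspan :: "'f::field \<Rightarrow> nat \<Rightarrow> 'f set" where
  "pspan \<xi> n = {\<Sum>i<n. of_int (c i) * \<xi> ^ i |c. True}"

lemma pspanI: "(\<Sum>i<n. of_int (c i) * \<xi> ^ i) \<in> pspan \<xi> n"
  unfolding pspan_def by blast

lemma pspan_0 [simp]: "pspan \<xi> 0 = {0}"
  by (auto simp: pspan_def)

lemma pspan_Suc: "pspan \<xi> (Suc n) = {of_int m * \<xi> ^ n + v |m v. v \<in> pspan \<xi> n}"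
proof (intro equalityI subsetI)
  fix x assume "x \<in> {of_int m * \<xi> ^ n + v |m v. v \<in> pspan \<xi> n}"
  then obtain m c where x: "x = of_int m * \<xi> ^ n + (\<Sum>i<n. of_int (c i) * \<xi> ^ i)"
    by (auto simp: pspan_def)
  have "x = (\<Sum>i<Suc n. of_int ((c(n := m)) i) * \<xi> ^ i)"
    by (simp add: x)
  then show "x \<in> pspan \<xi> (Suc n)"
    unfolding pspan_def by blast
qed (auto simp: pspan_def add.commute, metis add.commute)

lemma pspan_SucI: "v \<in> pspan \<xi> n \<Longrightarrow> of_int m * \<xi> ^ n + v \<in> pspan \<xi> (Suc n)"
  unfolding pspan_Suc by blast

lemma pspan_add: "x \<in> pspan \<xi> n \<Longrightarrow> y \<in> pspan \<xi> n \<Longrightarrow> x + y \<in> pspan \<xi> n"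
proof (induction n arbitrary: x y)
  case (Suc n)
  then obtain a v b w where "x = of_int a * \<xi> ^ n + v" "y = of_int b * \<xi> ^ n + w"
    "v \<in> pspan \<xi> n" "w \<in> pspan \<xi> n"
    by (auto simp: pspan_Suc)
  moreover from this have "x + y = of_int (a + b) * \<xi> ^ n + (v + w)"
    by (simp add: algebra_simps)
  ultimately show ?case using Suc.IH pspan_SucI by metis
qed simp

lemma pspan_scale: "x \<in> pspan \<xi> n \<Longrightarrow> of_int m * x \<in> pspan \<xi> n"
proof (induction n arbitrary: x)
  case (Suc n)
  then obtain a v where "x = of_int a * \<xi> ^ n + v" "v \<in> pspan \<xi> n"
    by (auto simp: pspan_Suc)
  moreover from this have "of_int m * x = of_int (m * a) * \<xi> ^ n + of_int m * v"
    by (simp add: algebra_simps)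
  ultimately show ?case using Suc.IH pspan_SucI by metis
qed simp

lemma pspan_diff: "x \<in> pspan \<xi> n \<Longrightarrow> y \<in> pspan \<xi> n \<Longrightarrow> x - y \<in> pspan \<xi> n"
  using pspan_add[of x \<xi> n "of_int (-1) * y"] pspan_scale[of y \<xi> n "-1"] by simp

lemma pspan_mono: "m \<le> n \<Longrightarrow> pspan \<xi> m \<subseteq> pspan \<xi> n"
proof (induction rule: dec_induct)
  case (step n)
  have "pspan \<xi> n \<subseteq> pspan \<xi> (Suc n)"
    using pspan_SucI[of _ \<xi> n 0] by auto
  with step.IH show ?case by blast
qed simp

text \<open>Splits off the constant term, where \<open>pspan_Suc\<close> splits off the top power.
  What remains is \<open>\<xi>\<close> times a span, the form that \<open>Xi\<close> takes in
  \<open>Xi_eq_pspan\<close>.\<close>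

lemma pspan_shift: "pspan \<xi> (Suc n) = {of_int m + \<xi> * v |m v. v \<in> pspan \<xi> n}"
proof (intro equalityI subsetI)
  fix x assume "x \<in> pspan \<xi> (Suc n)"
  then obtain c where "x = (\<Sum>i<Suc n. of_int (c i) * \<xi> ^ i)"
    by (auto simp: pspan_def)
  also have "\<dots> = of_int (c 0) + \<xi> * (\<Sum>i<n. of_int (c (Suc i)) * \<xi> ^ i)"
    by (subst sum.lessThan_Suc_shift) (simp add: sum_distrib_left algebra_simps)
  finally have "x = of_int (c 0) + \<xi> * (\<Sum>i<n. of_int (c (Suc i)) * \<xi> ^ i)" .
  moreover have "(\<Sum>i<n. of_int (c (Suc i)) * \<xi> ^ i) \<in> pspan \<xi> n"
    by (rule pspanI)
  ultimately show "x \<in> {of_int m + \<xi> * v |m v. v \<in> pspan \<xi> n}"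
    by blast
next
  fix x assume "x \<in> {of_int m + \<xi> * v |m v. v \<in> pspan \<xi> n}"
  then obtain m c where x: "x = of_int m + \<xi> * (\<Sum>i<n. of_int (c i) * \<xi> ^ i)"
    by (auto simp: pspan_def)
  have "x = (\<Sum>i<Suc n. of_int (case i of 0 \<Rightarrow> m | Suc j \<Rightarrow> c j) * \<xi> ^ i)"
    by (subst sum.lessThan_Suc_shift) (simp add: x sum_distrib_left algebra_simps)
  then show "x \<in> pspan \<xi> (Suc n)"
    unfolding pspan_def by (auto intro!: exI[of _ "\<lambda>i. case i of 0 \<Rightarrow> m | Suc j \<Rightarrow> c j"])
qed

lemma Xi_eq_pspan:
  assumes "r > 0"
  shows "Xi \<xi> r = (\<lambda>v. \<xi> * v) ` pspan \<xi> (r - 1)"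
proof -
  have eq: "(\<Sum>i = 1..<r. of_int (c i) * \<xi> ^ i) = \<xi> * (\<Sum>i<r - 1. of_int (c (Suc i)) * \<xi> ^ i)"
    for c
    unfolding sum_distrib_left
  proof (rule sum.reindex_bij_witness[of _ Suc "\<lambda>i. i - 1"])
    fix i assume "i \<in> {1..<r}"
    then obtain j where "i = Suc j" by (cases i) auto
    then show "\<xi> * (of_int (c (Suc (i - 1))) * \<xi> ^ (i - 1)) = of_int (c i) * \<xi> ^ i"
      by simp
  qed auto
  show ?thesis
  proof (intro equalityI subsetI)
    fix x assume "x \<in> Xi \<xi> r"
    then obtain c where "x = \<xi> * (\<Sum>i<r - 1. of_int (c (Suc i)) * \<xi> ^ i)"
      unfolding Xi_def eq by blast
    then show "x \<in> (\<lambda>v. \<xi> * v) ` pspan \<xi> (r - 1)"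
      using pspanI by (rule image_eqI)
  next
    fix x assume "x \<in> (\<lambda>v. \<xi> * v) ` pspan \<xi> (r - 1)"
    then obtain c where "x = \<xi> * (\<Sum>i<r - 1. of_int (c i) * \<xi> ^ i)"
      by (auto simp: pspan_def)
    then have "x = (\<Sum>i = 1..<r. of_int ((\<lambda>j. c (j - 1)) i) * \<xi> ^ i)"
      unfolding eq by simp
    then show "x \<in> Xi \<xi> r"
      unfolding Xi_def by (intro CollectI exI[of _ "\<lambda>j. c (j - 1)"]) simp
  qed
qed

lemma Xi_diff: "x \<in> Xi \<xi> r \<Longrightarrow> y \<in> Xi \<xi> r \<Longrightarrow> r > 0 \<Longrightarrow> x - y \<in> Xi \<xi> r"
  unfolding Xi_eq_pspan using pspan_diff by (fastforce simp flip: right_diff_distrib)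

section \<open>The field as the sum of the prime field and Xi\<close>

context
  fixes p r :: nat and \<xi> :: "'f::{field,finite}"
  assumes prime: "prime p" and card: "CARD('f) = p ^ r"
    and gen: "range (\<lambda>n::int. \<xi> powi n) = UNIV - {0}"
begin

lemma CHAR_p: "CHAR('f) = p"
  using CHAR_eq_of_CARD_prime_power prime card .

lemma gen_nonzero: "\<xi> \<noteq> 0"
proof
  assume "\<xi> = 0"
  then have "\<xi> powi 1 = 0" by simp
  then show False using gen by (metis DiffE insertI1 rangeI)
qed

lemma gen_nat_power:
  assumes "x \<noteq> 0"
  shows "\<exists>n::nat. x = \<xi> ^ n"
proof -
  obtain k :: int where k: "x = \<xi> powi k"
    using assms gen by (metis DiffI UNIV_I empty_iff imageE insert_iff)
  \<comment> \<open>By finiteness two powers of \<open>\<xi>\<close> coincide, which gives an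
    \<open>m > 0\<close> with \<open>\<xi>^m = 1\<close>.\<close>
  have "\<not> inj (\<lambda>n::nat. \<xi> ^ n)"
    using finite_imageD[of "\<lambda>n::nat. \<xi> ^ n" UNIV] by auto
  then obtain a b :: nat where ab: "a < b" "\<xi> ^ a = \<xi> ^ b"
    unfolding inj_def by (metis linorder_neqE_nat)
  define m where "m = b - a"
  have "a + m = b" using ab(1) by (simp add: m_def)
  then have "\<xi> ^ a * \<xi> ^ m = \<xi> ^ a * 1"
    using ab(2) by (metis mult_1_right power_add)
  then have m: "\<xi> ^ m = 1" "m > 0"
    using gen_nonzero ab(1) by (simp_all add: m_def)
  \<comment> \<open>Adding the multiple \<open>m |k|\<close> of the period makes the exponent
    nonnegative.\<close>
  have "x = \<xi> powi k * (\<xi> powi int m) powi \<bar>k\<bar>"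
    by (simp add: k m(1))
  also have "\<dots> = \<xi> powi (k + int m * \<bar>k\<bar>)"
    using gen_nonzero by (simp add: power_int_add power_int_mult)
  also have "k + int m * \<bar>k\<bar> \<ge> 0"
  proof -
    have "1 * \<bar>k\<bar> \<le> int m * \<bar>k\<bar>" using m(2) by (intro mult_right_mono) auto
    then show ?thesis by linarith
  qed
  then have "\<xi> powi (k + int m * \<bar>k\<bar>) = \<xi> ^ nat (k + int m * \<bar>k\<bar>)"
    by (simp add: power_int_def)
  finally show ?thesis by blast
qed

lemma card_pspan_le: "card (pspan \<xi> n) \<le> p ^ n"
proof (induction n)
  case (Suc n)
  have "pspan \<xi> (Suc n) \<subseteq> (\<lambda>(k, v). of_nat k * \<xi> ^ n + v) ` ({..<p} \<times> pspan \<xi> n)"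
  proof
    fix x assume "x \<in> pspan \<xi> (Suc n)"
    then obtain m v where x: "x = of_int m * \<xi> ^ n + v" "v \<in> pspan \<xi> n"
      by (auto simp: pspan_Suc)
    obtain k where "k < p" "(of_int m :: 'f) = of_nat k"
      using of_int_eq_of_nat_CHAR[where ?'f = 'f, of m] prime prime_gt_0_nat by (auto simp: CHAR_p)
    then show "x \<in> (\<lambda>(k, v). of_nat k * \<xi> ^ n + v) ` ({..<p} \<times> pspan \<xi> n)"
      using x by force
  qed
  then have "card (pspan \<xi> (Suc n)) \<le> card ({..<p} \<times> pspan \<xi> n)"
    by (rule surj_card_le[rotated]) simp
  also have "\<dots> \<le> p * p ^ n"
    using Suc.IH by (simp add: card_cartesian_product)
  finally show ?case by simp
qed simp

text \<open>If some \<open>\<xi>^d\<close> with \<open>d < r\<close> lies in the span of the lower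
  powers, that span is stable under \<open>\<xi>\<close>, so it contains every power and hence the
  whole field. Otherwise each new power multiplies the size of the span by \<open>p\<close>, and the
  span of \<open>r\<close> powers has q elements.\<close>

lemma pspan_eq_UNIV: "pspan \<xi> r = UNIV"
proof (cases "\<exists>d<r. \<xi> ^ d \<in> pspan \<xi> d")
  case True
  then obtain d where d: "d < r" "\<xi> ^ d \<in> pspan \<xi> d" by blast
  \<comment> \<open>\<open>d = 0\<close> is impossible, because \<open>\<xi>^0 = 1\<close> is not in
    \<open>pspan \<xi> 0 = {0}\<close>.\<close>
  then obtain e where e: "d = Suc e"
    by (cases d) auto
  have step: "\<xi> * v \<in> pspan \<xi> d" if v: "v \<in> pspan \<xi> d" for v
  proof -
    have "\<xi> * v \<in> pspan \<xi> (Suc d)"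
      using v unfolding pspan_shift[of _ d] by (metis (mono_tags, lifting) CollectI add_0 of_int_0)
    then obtain m w where "\<xi> * v = of_int m * \<xi> ^ d + w" "w \<in> pspan \<xi> d"
      by (auto simp: pspan_Suc)
    then show ?thesis using d(2) pspan_add pspan_scale by metis
  qed
  have pow: "\<xi> ^ n \<in> pspan \<xi> d" for n
  proof (induction n)
    case 0
    have "pspan \<xi> 1 \<subseteq> pspan \<xi> d" by (rule pspan_mono) (simp add: e)
    moreover have "1 \<in> pspan \<xi> 1"
      using pspan_SucI[of 0 \<xi> 0 1] by simp
    ultimately show ?case by auto
  next
    case (Suc n)
    then show ?case using step by simp
  qed
  have "x \<in> pspan \<xi> d" for x
  proof (cases "x = 0")
    case True
    then show ?thesis using pspan_diff[OF d(2) d(2)] by simp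
  next
    case False
    then show ?thesis using gen_nat_power[of x] pow by blast
  qed
  then show ?thesis using pspan_mono[of d r \<xi>] d(1) by auto
next
  case False
  have "card (pspan \<xi> n) \<ge> p ^ n" if "n \<le> r" for n
    using that
  proof (induction n)
    case (Suc n)
    have notin: "\<xi> ^ n \<notin> pspan \<xi> n" using False Suc.prems by auto
    have "inj_on (\<lambda>(k, v). of_nat k * \<xi> ^ n + v) ({..<p} \<times> pspan \<xi> n)"
    proof (rule inj_onI)
      fix x y
      assume xy: "x \<in> {..<p} \<times> pspan \<xi> n" "y \<in> {..<p} \<times> pspan \<xi> n"
        and "(case x of (k, v) \<Rightarrow> of_nat k * \<xi> ^ n + v) = (case y of (k, v) \<Rightarrow> of_nat k * \<xi> ^ n + v)"
      then obtain k v l w where kl: "k \<in> {..<p}" "l \<in> {..<p}"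
        and vw: "v \<in> pspan \<xi> n" "w \<in> pspan \<xi> n"
        and eq: "of_nat k * \<xi> ^ n + v = of_nat l * \<xi> ^ n + w"
        and pairs: "x = (k, v)" "y = (l, w)"
        by auto
      define m where "m = int k - int l"
      have m: "of_int m * \<xi> ^ n = w - v"
        using eq by (simp add: m_def algebra_simps)
      \<comment> \<open>If \<open>k\<close> and \<open>l\<close> differed, \<open>k - l\<close>
        would be invertible modulo \<open>p\<close>, and dividing by it would put
        \<open>\<xi>^n\<close> into the span of the lower powers.\<close>
      have "k = l"
      proof (rule ccontr)
        assume "k \<noteq> l"
        then have "\<not> int p dvd m"
          using kl zdvd_not_zless[of "\<bar>m\<bar>" "int p"] by (auto simp: m_def)
        then have "coprime m (int p)"
          using prime by (metis coprime_commute prime_imp_coprime prime_nat_int_transfer)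
        then obtain u t where "u * m + t * int p = 1"
          by (metis bezout_int coprime_iff_gcd_eq_1)
        then have "of_int (u * m + t * int p) = (1 :: 'f)" by simp
        then have "of_int u * of_int m = (1 :: 'f)"
          using of_nat_CHAR[where ?'a = 'f] by (simp add: CHAR_p)
        then have "\<xi> ^ n = of_int u * (of_int m * \<xi> ^ n)"
          by (metis mult.assoc mult_1)
        also have "\<dots> \<in> pspan \<xi> n"
          unfolding m using vw by (intro pspan_scale pspan_diff)
        finally show False using notin by contradiction
      qed
      then show "x = y" using eq by (simp add: pairs)
    qed
    then have "card ((\<lambda>(k, v). of_nat k * \<xi> ^ n + v) ` ({..<p} \<times> pspan \<xi> n)) = p * card (pspan \<xi> n)"
      by (simp add: card_image card_cartesian_product)
    moreover have "(\<lambda>(k, v). of_nat k * \<xi> ^ n + v) ` ({..<p} \<times> pspan \<xi> n) \<subseteq> pspan \<xi> (Suc n)"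
      unfolding pspan_Suc by (auto, metis of_int_of_nat_eq)
    ultimately have "p * card (pspan \<xi> n) \<le> card (pspan \<xi> (Suc n))"
      by (metis card_mono finite)
    moreover have "p * p ^ n \<le> p * card (pspan \<xi> n)"
      using Suc by simp
    ultimately show ?case by (metis le_trans power_Suc)
  qed simp
  from this[of r] have "card (pspan \<xi> r) = CARD('f)"
    using card card_mono[of UNIV "pspan \<xi> r"] by simp
  then show ?thesis
    by (intro card_subset_eq) simp_all
qed

text \<open>Lets a translation by any field element be handled as one by an integer followed by one
  inside \<open>Xi\<close>.\<close>

lemma Xi_decompose:
  assumes "r > 0"
  shows "\<exists>n<p. \<exists>\<zeta>\<in>Xi \<xi> r. b = of_nat n + \<zeta>"
proof -
  have "b \<in> pspan \<xi> (Suc (r - 1))"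
    using pspan_eq_UNIV assms by simp
  then obtain m v where mv: "b = of_int m + \<xi> * v" "v \<in> pspan \<xi> (r - 1)"
    by (auto simp: pspan_shift)
  obtain k where "k < p" "(of_int m :: 'f) = of_nat k"
    using of_int_eq_of_nat_CHAR[where ?'f = 'f, of m] prime prime_gt_0_nat by (auto simp: CHAR_p)
  then show ?thesis using mv Xi_eq_pspan[OF assms, of \<xi>] by auto
qed

text \<open>One inequality counts coefficient vectors, the other uses \<open>Xi_decompose\<close>.
  The equality shows that \<open>C\<close> has degree q in \<open>y\<close>.\<close>

lemma card_Xi:
  assumes "r > 0"
  shows "p * card (Xi \<xi> r) = CARD('f)"
proof (rule antisym)
  have "card (Xi \<xi> r) \<le> p ^ (r - 1)"
    unfolding Xi_eq_pspan[OF assms]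
    by (rule order.trans[OF card_image_le card_pspan_le]) simp
  then have "p * card (Xi \<xi> r) \<le> p * p ^ (r - 1)" by simp
  then show "p * card (Xi \<xi> r) \<le> CARD('f)"
    using assms by (simp add: card flip: power_Suc)
  have "UNIV \<subseteq> (\<lambda>(n, \<zeta>). of_nat n + \<zeta>) ` ({..<p} \<times> Xi \<xi> r)"
    using Xi_decompose[OF assms] by (force simp: image_iff)
  then have "CARD('f) \<le> card ({..<p} \<times> Xi \<xi> r)"
    by (rule surj_card_le[rotated]) simp
  then show "CARD('f) \<le> p * card (Xi \<xi> r)"
    by (simp add: card_cartesian_product)
qed

end

section \<open>Centrality of the product\<close>

lemma weyl_power:
  fixes x w :: "'a::ring_1"
  assumes "x * w = w * x + 1"
  shows "x * w ^ Suc n = w ^ Suc n * x + of_nat (Suc n) * w ^ n"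
proof (induction n)
  case (Suc n)
  have "x * w ^ Suc (Suc n) = (x * w ^ Suc n) * w"
    by (simp only: power_Suc2 mult.assoc)
  also have "\<dots> = w ^ Suc n * (x * w) + of_nat (Suc n) * w ^ Suc n"
    unfolding Suc.IH by (simp only: power_Suc2 distrib_right mult.assoc)
  also have "\<dots> = w ^ Suc (Suc n) * x + of_nat (Suc (Suc n)) * w ^ Suc n"
    unfolding assms by (simp add: power_Suc2 algebra_simps del: power_Suc)
  finally show ?case .
qed (use assms in simp)

text \<open>Each of the \<open>m\<close> passages of \<open>g\<close> past a factor \<open>w\<close>
  leaves an \<open>x\<close>, and moving that \<open>x\<close> past a later \<open>w\<close> leaves
  1; the pairs of factors give the binomial coefficient. Writing \<open>m = n + 2\<close> avoids
  truncated exponents.\<close>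

lemma weyl_power_grp:
  fixes x w g :: "'a::ring_1"
  assumes "x * w = w * x + 1" "g * w = w * g + x"
  shows "g * w ^ Suc (Suc n) = w ^ Suc (Suc n) * g + of_nat (Suc (Suc n)) * w ^ Suc n * x
    + of_nat (Suc (Suc n) choose 2) * w ^ n"
proof (induction n)
  case 0
  have "g * w ^ 2 = (g * w) * w" by (simp add: power2_eq_square mult.assoc)
  also have "\<dots> = w * (g * w) + x * w" by (simp add: assms(2) algebra_simps)
  also have "\<dots> = w ^ 2 * g + 2 * w * x + 1"
    by (simp add: assms power2_eq_square algebra_simps mult_2)
  finally show ?case by (simp add: numeral_2_eq_2)
next
  case (Suc n)
  let ?m = "Suc (Suc n)"
  have "g * w ^ Suc ?m = (g * w ^ ?m) * w"
    by (simp only: power_Suc2 mult.assoc)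
  also have "\<dots> = w ^ ?m * (g * w) + of_nat ?m * (w ^ Suc n * (x * w)) + of_nat (?m choose 2) * w ^ Suc n"
    unfolding Suc.IH by (simp only: power_Suc2 distrib_right mult.assoc)
  also have "\<dots> = w ^ Suc ?m * g + of_nat (Suc ?m) * w ^ ?m * x
    + of_nat ((?m choose 1) + (?m choose 2)) * w ^ Suc n"
    unfolding assms by (simp add: power_Suc2 algebra_simps del: power_Suc)
  also have "(?m choose 1) + (?m choose 2) = Suc ?m choose 2"
    by (simp add: numeral_2_eq_2)
  finally show ?case .
qed

lemma prod_list_commute_one:
  fixes z :: "'a::monoid_mult"
  assumes "\<And>u. u \<in> set us \<Longrightarrow> z * u = u * z"
  shows "z * prod_list us = prod_list us * z"
  using assms
proof (induction us)
  case (Cons u us)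
  have "z * prod_list (u # us) = u * (z * prod_list us)"
    using Cons.prems[of u] by (simp add: mult.assoc flip: mult.assoc)
  also have "\<dots> = prod_list (u # us) * z"
    using Cons by (simp add: mult.assoc)
  finally show ?case .
qed simp

lemma prod_list_permute:
  fixes f :: "'b \<Rightarrow> 'a::monoid_mult"
  assumes "\<And>i j. f i * f j = f j * f i" "mset xs = mset ys"
  shows "prod_list (map f xs) = prod_list (map f ys)"
  using assms(2)
proof (induction xs arbitrary: ys)
  case (Cons x xs)
  then have "x \<in> set ys" by (metis list.set_intros(1) mset_eq_setD)
  then obtain us vs where ys: "ys = us @ x # vs" by (meson split_list)
  with Cons.prems have "mset xs = mset (us @ vs)" by simp
  from Cons.IH[OF this] have "prod_list (map f xs) = prod_list (map f (us @ vs))" .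
  then have "prod_list (map f (x # xs)) = (f x * prod_list (map f us)) * prod_list (map f vs)"
    by (simp add: mult.assoc)
  also have "f x * prod_list (map f us) = prod_list (map f us) * f x"
    using assms(1) by (intro prod_list_commute_one) auto
  finally show ?case by (simp add: ys mult.assoc)
qed simp

section \<open>The factors of C as conjugates of y\<close>

lemma oX_oY: "oX * oY = oY * oX + oG (1 :: 'f::field)"
  by (simp add: oY_ybase)

lemma oG_oY: "oG a * oY = (oY + oK (to_ac a) * oX) * oG a"
proof -
  have "oY * oG a = oG a * oY - oK (to_ac a) * oX * oG a"
    by (simp add: oY_ybase delta_bG del: mult_pCons_left mult_pCons_right)
  then show ?thesis by (simp add: distrib_right)
qed

lemma oG_mult: "oG a * oG b = oG (a + b)"
  by (simp add: bG_simps)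

lemma oG_0 [simp]: "oG 0 = 1"
  by (simp add: bG_simps)

lemma oK_commute: "oK c * u = u * oK c"
proof (rule ore_centralI)
  show "oK c * oY = oY * oK c" by (simp add: oY_ybase)
qed (rule ybase_commute)+

definition ofactor :: "'f::field \<Rightarrow> 'f ore" where
  "ofactor a = oY - oK (to_ac a) * oX"

lemma ofactor_conj: "ofactor a = oG (- a) * oY * oG a"
  by (simp add: ofactor_def oG_oY oG_mult mult.assoc)

definition weylY :: "'f::field ore" where "weylY = oG (- 1) * oY"

lemma oY_weylY: "oY = oG 1 * weylY"
  by (simp add: weylY_def oG_mult flip: mult.assoc)

lemma oX_weylY: "oX * weylY = weylY * oX + 1"
proof -
  have "oX * weylY = oG (- 1) * (oX * oY)"
    by (simp add: weylY_def ybase_commute flip: mult.assoc)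
  also have "\<dots> = weylY * oX + oG (- 1) * oG 1"
    by (simp add: oX_oY weylY_def algebra_simps)
  finally show ?thesis by (simp add: oG_mult)
qed

lemma oG_weylY: "oG 1 * weylY = weylY * oG 1 + oX"
proof -
  have "oY = oG (- 1) * (oG 1 * oY)"
    by (simp add: oG_mult flip: mult.assoc)
  also have "oG 1 * oY = (oY + oX) * oG 1"
    using oG_oY[of 1] by simp
  also have "oG (- 1) * ((oY + oX) * oG 1) = weylY * oG 1 + oG (- 1) * oX * oG 1"
    by (simp only: weylY_def distrib_left distrib_right mult.assoc)
  also have "oG (- 1) * oX * oG 1 = oX"
    by (simp only: ybase_commute[of "bG (- 1)" bX] mult.assoc oG_mult) simp
  finally show ?thesis unfolding oY_weylY[symmetric] .
qed

text \<open>Adjacent conjugates meet in a product of group elements whose entries differ by one,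
  that is in \<open>g_1^-1\<close>, which turns the following \<open>y\<close> into
  \<open>w\<close>. This uses the increasing order of the factors.\<close>

lemma prod_ofactor:
  "(\<Prod>a\<leftarrow>[1..<n + 1]. ofactor (\<zeta> + of_nat a)) = oG (- \<zeta>) * weylY ^ n * oG (\<zeta> + of_nat n)"
proof (induction n)
  case 0
  show ?case by (simp add: oG_mult)
next
  case (Suc n)
  have "(\<Prod>a\<leftarrow>[1..<Suc n + 1]. ofactor (\<zeta> + of_nat a)) =
    oG (- \<zeta>) * weylY ^ n * oG (\<zeta> + of_nat n) * ofactor (\<zeta> + of_nat (Suc n))"
    using Suc.IH by simp
  also have "\<dots> = oG (- \<zeta>) * weylY ^ n * (oG (\<zeta> + of_nat n) * oG (- (\<zeta> + of_nat (Suc n)))) * oY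
    * oG (\<zeta> + of_nat (Suc n))"
    by (simp only: ofactor_conj mult.assoc)
  also have "oG (\<zeta> + of_nat n) * oG (- (\<zeta> + of_nat (Suc n))) = oG (- 1)"
    by (simp add: oG_mult)
  also have "oG (- \<zeta>) * weylY ^ n * oG (- 1) * oY = oG (- \<zeta>) * weylY ^ Suc n"
    by (simp only: weylY_def power_Suc2 mult.assoc)
  finally show ?case .
qed

section \<open>The inner products and their symmetries\<close>

definition oD :: "nat \<Rightarrow> 'f::field \<Rightarrow> 'f ore" where
  "oD p \<zeta> = (\<Prod>a\<leftarrow>[1..<p + 1]. ofactor (\<zeta> + of_nat a))"

lemma of_nat_ore: "of_nat n = (oK (of_nat n) :: 'f::field ore)"
  by (induction n) simp_all

context
  fixes p :: nat
  assumes p: "prime p" "odd p" and char: "CHAR('f::field) = p"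
begin

lemma of_nat_p_field: "of_nat p = (0 :: 'f)"
  using char of_nat_CHAR by metis

lemma of_nat_p_ore:
  assumes "p dvd n"
  shows "of_nat n = (0 :: 'f ore)"
proof -
  have "of_nat n = (0 :: 'f alg_closure)"
    using assms by (simp add: of_nat_eq_0_iff_char_dvd char)
  then show ?thesis by (simp add: of_nat_ore)
qed

lemma weylY_pow_oX: "oX * weylY ^ p = weylY ^ p * (oX :: 'f ore)"
  using weyl_power[OF oX_weylY[where ?'a = 'f], of "p - 1"] p(1) prime_gt_0_nat[of p] of_nat_p_ore[of p]
  by simp

lemma weylY_pow_oG: "oG 1 * weylY ^ p = weylY ^ p * (oG 1 :: 'f ore)"
proof -
  \<comment> \<open>Oddness makes \<open>p\<close> divide \<open>p choose 2\<close>, so that both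
    error terms of \<open>weyl_power_grp\<close> vanish.\<close>
  have "p > 2" using p prime_ge_2_nat[of p] by (cases "p = 2") auto
  then have "p dvd (p choose 2)" using p(1) by (intro dvd_choose_prime) auto
  moreover obtain n where "p = Suc (Suc n)" using \<open>p > 2\<close> by (metis Suc_diff_Suc less_2_cases_iff less_trans_Suc not0_implies_Suc not_less_iff_gr_or_eq)
  ultimately show ?thesis
    using weyl_power_grp[OF oX_weylY oG_weylY[where ?'a = 'f], of n] of_nat_p_ore[of p] of_nat_p_ore[of "p choose 2"]
    by (simp del: power_Suc of_nat_Suc binomial_Suc_Suc)
qed

lemma weylY_pow_oY: "oY * weylY ^ p = weylY ^ p * (oY :: 'f ore)"
  by (metis weylY_pow_oG oY_weylY mult.assoc power_commutes)

text \<open>At \<open>n = p\<close> the right end of the telescoped product has entry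
  \<open>\<zeta> + p = \<zeta>\<close>, so the product becomes a genuine conjugate.\<close>

lemma oD_conj: "oD p \<zeta> = oG (- \<zeta>) * weylY ^ p * oG (\<zeta> :: 'f)"
  using prod_ofactor[of \<zeta> p] by (simp add: oD_def of_nat_p_field)

lemma oD_shift: "oG b * oD p \<zeta> = oD p (\<zeta> - b) * oG (b :: 'f)"
  by (simp add: oD_conj mult.assoc oG_mult) (simp add: oG_mult flip: mult.assoc)

lemma oD_oX: "oX * oD p \<zeta> = oD p \<zeta> * (oX :: 'f ore)"
proof -
  have "oX * oD p \<zeta> = oG (- \<zeta>) * (oX * weylY ^ p) * oG \<zeta>"
    by (simp add: oD_conj ybase_commute[of bX] flip: mult.assoc)
  also have "\<dots> = oD p \<zeta> * oX"
    by (simp add: oD_conj weylY_pow_oX mult.assoc ybase_commute[of bX])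
  finally show ?thesis .
qed

lemma oD_oY: "oY * oD p \<zeta> = oD p \<zeta> * (oY :: 'f ore)"
proof -
  \<comment> \<open>Conjugating \<open>y\<close> past the outer group element turns it into
    \<open>?u\<close>, which commutes with \<open>w^p\<close> because \<open>x\<close> and
    \<open>y\<close> do.\<close>
  let ?u = "oY + oK (to_ac \<zeta>) * oX"
  have comm: "?u * weylY ^ p = weylY ^ p * ?u"
    by (simp add: distrib_left distrib_right weylY_pow_oY mult.assoc weylY_pow_oX)
      (metis mult.assoc oK_commute)
  have u: "oG \<zeta> * oY = ?u * oG \<zeta>" by (rule oG_oY)
  then have "oY * oG (- \<zeta>) = oG (- \<zeta>) * ?u"
    by (metis (no_types, lifting) add.left_inverse add.right_inverse mult.assoc mult_1_left
        mult_1_right oG_0 oG_mult)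
  then have "oY * oD p \<zeta> = oG (- \<zeta>) * (?u * weylY ^ p) * oG \<zeta>"
    by (simp add: oD_conj flip: mult.assoc)
  also have "\<dots> = oD p \<zeta> * oY"
    by (simp add: comm oD_conj u mult.assoc)
  finally show ?thesis .
qed

text \<open>An inner product commutes with \<open>x\<close>, \<open>y\<close> and scalars, hence
  with every linear factor of another one.\<close>

lemma oD_commute: "oD p \<zeta> * oD p \<eta> = oD p \<eta> * oD p (\<zeta> :: 'f)"
  unfolding oD_def[of p \<eta>]
proof (rule prod_list_commute_one)
  fix u assume "u \<in> set (map (\<lambda>a. ofactor (\<eta> + of_nat a)) [1..<p + 1])"
  then obtain b where "u = ofactor b" by auto
  moreover have "oD p \<zeta> * (oK c * oX) = oK c * oX * oD p \<zeta>" for c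
    by (simp only: mult.assoc oD_oX) (simp only: oK_commute[of c "oD p \<zeta>"] flip: mult.assoc)
  ultimately show "oD p \<zeta> * u = u * oD p \<zeta>"
    by (simp only: ofactor_def left_diff_distrib right_diff_distrib oD_oY)
qed

text \<open>\<open>w^p\<close> commutes with the powers of \<open>g_1\<close>. Hence
  \<open>oD\<close> depends only on the class of \<open>\<zeta>\<close> modulo the prime field, and
  \<open>Xi\<close> supplies representatives of the classes.\<close>

lemma oD_shift_nat: "oD p (\<zeta> - of_nat n) = oD p (\<zeta> :: 'f)"
proof -
  have "oG (of_nat n) * weylY ^ p = weylY ^ p * (oG (of_nat n) :: 'f ore)"
  proof (induction n)
    case (Suc n)
    then show ?case
      by (metis (no_types, lifting) mult.assoc oG_mult of_nat_Suc weylY_pow_oG)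
  qed simp
  then have "oG (of_nat n - \<zeta>) * weylY ^ p * oG (\<zeta> - of_nat n) =
     oG (- \<zeta>) * weylY ^ p * (oG (of_nat n) * oG (\<zeta> - of_nat n))"
    by (metis (no_types, lifting) mult.assoc oG_mult uminus_add_conv_diff)
  then show ?thesis by (simp add: oD_conj oG_mult)
qed

end

section \<open>The full product C\<close>

definition oC :: "nat \<Rightarrow> 'f::field list \<Rightarrow> 'f ore" where
  "oC p zs = (\<Prod>\<zeta>\<leftarrow>zs. oD p \<zeta>)"

text \<open>Each inner product already commutes with \<open>x\<close>, \<open>y\<close> and scalars.
  Only commutation with group elements needs the full product, whose factors are permuted by
  conjugation.\<close>

lemma oC_central:
  fixes \<xi> :: "'f::{field,finite}"
  assumes "prime p" "odd p" "r > 0" "CARD('f) = p ^ r"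
    and "range (\<lambda>n::int. \<xi> powi n) = UNIV - {0}"
    and "set zs = Xi \<xi> r" "distinct zs"
  shows "oC p zs * u = u * oC p zs"
proof (rule ore_centralI)
  have char: "CHAR('f) = p"
    using assms(1,4) by (rule CHAR_eq_of_CARD_prime_power)
  note D = assms(1,2) char
  show "oC p zs * oK c = oK c * oC p zs" for c
    by (rule oK_commute[symmetric])
  show "oC p zs * oX = oX * oC p zs" "oC p zs * oY = oY * oC p zs"
    unfolding oC_def using oD_oX[OF D] oD_oY[OF D]
    by (auto intro!: prod_list_commute_one[symmetric])
  fix b
  \<comment> \<open>Conjugation translates the index by \<open>b\<close>. The integer part
    \<open>n\<close> is absorbed by \<open>oD_shift_nat\<close>, leaving a translation by an element
    of \<open>Xi\<close>.\<close>
  obtain n \<beta> where b: "b = of_nat n + \<beta>" "\<beta> \<in> Xi \<xi> r"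
    using Xi_decompose[OF assms(1,4,5,3)] by blast
  have 0: "0 \<in> Xi \<xi> r" using Xi_diff[OF b(2) b(2) assms(3)] by simp
  have "oG b * (\<Prod>\<zeta>\<leftarrow>xs. oD p \<zeta>) = (\<Prod>\<zeta>\<leftarrow>xs. oD p (\<zeta> - b)) * oG b" for xs
    by (induction xs) (simp_all, metis mult.assoc oD_shift[OF D])
  moreover have "oD p (\<zeta> - b) = oD p (\<zeta> - \<beta>)" for \<zeta>
    using oD_shift_nat[OF D, of "\<zeta> - \<beta>" n] by (simp add: b(1) algebra_simps)
  ultimately have "oG b * oC p zs = (\<Prod>\<zeta>\<leftarrow>map (\<lambda>\<zeta>. \<zeta> - \<beta>) zs. oD p \<zeta>) * oG b"
    by (simp add: oC_def comp_def)
  also have "(\<Prod>\<zeta>\<leftarrow>map (\<lambda>\<zeta>. \<zeta> - \<beta>) zs. oD p \<zeta>) = oC p zs"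
    unfolding oC_def
  proof (rule prod_list_permute)
    show "oD p i * oD p j = oD p j * oD p i" for i j :: 'f by (rule oD_commute[OF D])
    have "(\<lambda>\<zeta>. \<zeta> - \<beta>) ` Xi \<xi> r = Xi \<xi> r"
    proof (intro equalityI subsetI)
      fix x assume x: "x \<in> Xi \<xi> r"
      \<comment> \<open>This is \<open>x + \<beta>\<close>, obtained from closure under differences
        alone.\<close>
      have "x - (0 - \<beta>) \<in> Xi \<xi> r" by (intro Xi_diff assms(3) 0 b(2) x)
      then show "x \<in> (\<lambda>\<zeta>. \<zeta> - \<beta>) ` Xi \<xi> r" by (intro image_eqI[of _ _ "x - (0 - \<beta>)"]) simp_all
    qed (use Xi_diff b(2) assms(3) in auto)
    then show "mset (map (\<lambda>\<zeta>. \<zeta> - \<beta>) zs) = mset zs"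
      using assms(6,7) by (subst set_eq_iff_mset_eq_distinct[symmetric]) (auto simp: distinct_map inj_on_def)
  qed
  finally show "oC p zs * oG b = oG b * oC p zs" ..
qed

lemma prod_list_top:
  assumes "\<And>u. u \<in> set us \<Longrightarrow> ydeg u \<le> d \<and> ycoeff u d = 1"
  shows "ydeg (prod_list us) \<le> d * length us \<and> ycoeff (prod_list us) (d * length us) = 1"
  using assms
proof (induction us)
  case Nil
  show ?case by (simp add: ydeg_def ycoeff_def)
next
  case (Cons u us)
  then show ?case
    using ydeg_mult_le[of u d "prod_list us" "d * length us"]
      ycoeff_mult_top[of u d "prod_list us" "d * length us"] by simp
qed

lemma oD_top: "ydeg (oD p \<zeta>) \<le> p \<and> ycoeff (oD p \<zeta>) p = 1"
proof -
  have "ydeg (ofactor a) \<le> 1 \<and> ycoeff (ofactor a) 1 = 1" for a :: 'a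
    by (simp add: ofactor_def ydeg_def ycoeff_def)
  then show ?thesis
    unfolding oD_def using prod_list_top[of "map (\<lambda>a. ofactor (\<zeta> + of_nat a)) [1..<p + 1]" 1]
    by (simp add: image_iff del: upt_Suc) blast
qed

lemma oC_top: "ydeg (oC p zs) \<le> p * length zs" "ycoeff (oC p zs) (p * length zs) = 1"
  unfolding oC_def using prod_list_top[of "map (oD p) zs" p] oD_top by auto

section \<open>The center of the Ore extension\<close>

lemma degree_mult_top:
  fixes f g :: "'a::comm_semiring_1 poly"
  assumes "degree f \<le> m" "degree g \<le> n"
  shows "degree (f * g) \<le> m + n \<and> coeff (f * g) (m + n) = coeff f m * coeff g n"
proof -
  have le: "degree (f * g) \<le> degree f + degree g" by (rule degree_mult_le)
  show ?thesis
  proof (cases "degree f = m \<and> degree g = n")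
    case True
    then show ?thesis using le by (auto simp: coeff_mult_degree_sum)
  next
    case False
    then have "degree f + degree g < m + n" using assms by auto
    moreover have "coeff f m = 0 \<or> coeff g n = 0"
      using False assms by (auto simp: coeff_eq_0)
    ultimately show ?thesis using le by (auto simp: coeff_eq_0)
  qed
qed

lemma degree_power_top:
  fixes f :: "'a::comm_semiring_1 poly"
  assumes "degree f \<le> m" "coeff f m = 1"
  shows "degree (f ^ n) \<le> m * n \<and> coeff (f ^ n) (m * n) = 1"
proof (induction n)
  case (Suc n)
  then show ?case using degree_mult_top[OF assms(1), of "f ^ n" "m * n"] assms(2) by simp
qed simp

section \<open>The kernel of the derivation\<close>

definition bA :: "'f::field base" where "bA = bX ^ 2 - 2 * bG 1 + 2"

lemma delta_of_nat [simp]: "delta (of_nat n) = 0"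
  by (induction n) simp_all

text \<open>The contributions \<open>- 2 g_1 x\<close> of \<open>x^2\<close> and
  \<open>2 x g_1\<close> of \<open>- 2 g_1\<close> cancel.\<close>

lemma delta_bA: "delta bA = (0 :: 'f::field base)"
proof -
  have 2: "delta 2 = (0 :: 'f base)" using delta_of_nat[of 2] by simp
  have "delta (bX ^ 2) = - (2 * bG 1) * (bX :: 'f base)"
    unfolding power2_eq_square delta_mult delta_bX by (simp add: mult.commute)
  moreover have "delta (2 * bG 1) = - (2 * bX * bG (1 :: 'f))"
    unfolding delta_mult 2 delta_bG by simp
  ultimately show ?thesis
    by (simp add: bA_def 2 del: mult_pCons_left mult_pCons_right)
qed

lemma delta_power_Suc: "delta (f ^ Suc n) = of_nat (Suc n) * f ^ n * delta f"
proof (induction n)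
  case (Suc n)
  have "delta (f ^ Suc (Suc n)) = delta f * f ^ Suc n + f * delta (f ^ Suc n)"
    by (simp only: power_Suc[of f "Suc n"] delta_mult)
  then show ?case unfolding Suc.IH by (simp add: algebra_simps)
qed simp

lemma of_nat_base: "of_nat n = (bK (of_nat n) :: 'f::field base)"
  by (induction n) simp_all

definition bmon :: "nat \<Rightarrow> nat \<Rightarrow> nat \<Rightarrow> 'f::field base" where
  "bmon p i e = bA ^ i * (bX ^ p) ^ e"

lemma bmon_top:
  "degree (bmon p i e :: 'f::field base) \<le> 2 * i + p * e \<and>
   coeff (bmon p i e :: 'f base) (2 * i + p * e) = 1"
proof -
  have X: "degree (bX ^ n :: 'f base) \<le> n \<and> coeff (bX ^ n :: 'f base) n = 1" for n
    using degree_power_top[of "bX :: 'f base" 1 n] by simp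
  have 2: "(2 :: 'f base) = [:2:]" by (metis numeral_poly)
  have "degree (bA :: 'f base) \<le> 2"
    unfolding bA_def bG_def 2
    by (intro degree_add_le degree_diff_le X[THEN conjunct1]) simp_all
  moreover have "coeff (bA :: 'f base) 2 = 1"
    unfolding bA_def bG_def 2 using X[of 2] by (simp add: coeff_pCons numeral_2_eq_2)
  ultimately have A: "degree (bA ^ i :: 'f base) \<le> 2 * i \<and> coeff (bA ^ i :: 'f base) (2 * i) = 1"
    using degree_power_top by blast
  have B: "degree ((bX ^ p) ^ e :: 'f base) \<le> p * e \<and> coeff ((bX ^ p) ^ e :: 'f base) (p * e) = 1"
    using degree_power_top X[of p] by blast
  show ?thesis
    using degree_mult_top[OF A[THEN conjunct1] B[THEN conjunct1]] A B by (simp add: bmon_def)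
qed

text \<open>The part \<open>- g_1 d/dx\<close> lowers the degree in \<open>x\<close> and raises the
  entry by one; the part \<open>- x gder\<close> raises the degree and keeps the entry. So
  \<open>delta f = 0\<close> is a two-term recurrence.\<close>

lemma lookup_coeff_delta:
  "Poly_Mapping.lookup (coeff (delta f) k) a =
    - of_nat (Suc k) * Poly_Mapping.lookup (coeff f (Suc k)) (a - 1)
    - (if k = 0 then 0 else to_ac a * Poly_Mapping.lookup (coeff f (k - 1)) a)"
proof -
  have shift: "Poly_Mapping.lookup (Poly_Mapping.single 1 1 * u) a = Poly_Mapping.lookup u (a - 1)"
    for u :: "'a grp_alg"
  proof (induction u rule: pm_induct)
    case (single b c)
    have "1 + b = a \<longleftrightarrow> b = a - 1" by (auto simp: algebra_simps)
    then show ?case by (simp add: mult_single lookup_single when_def)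
  qed (simp_all add: lookup_add distrib_left)
  have nat: "Poly_Mapping.lookup (of_nat n * u) b = of_nat n * Poly_Mapping.lookup u b"
    for n b and u :: "'a grp_alg"
    by (induction n) (simp_all add: lookup_add algebra_simps)
  show ?thesis
    by (simp add: delta_def lookup_minus shift nat coeff_map_poly coeff_pCons del: of_nat_Suc
        split: nat.split)
qed

lemma delta_bmon:
  assumes "CHAR('f::field) = p" "p > 0"
  shows "delta (bmon p i e :: 'f base) = 0"
proof -
  have "delta (f ^ n) = 0" if "delta f = 0" for f :: "'f base" and n
    using that by (cases n) (simp_all add: delta_power_Suc del: power_Suc)
  moreover have "delta (bX ^ p) = (0 :: 'f base)"
  proof -
    have "of_nat p = (0 :: 'f alg_closure)" by (simp add: of_nat_eq_0_iff_char_dvd assms(1))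
    then show ?thesis
      using delta_power_Suc[of "bX :: 'f base" "p - 1"] assms(2) by (simp add: of_nat_base)
  qed
  ultimately show ?thesis
    using delta_bA[where ?'f = 'f] by (simp add: bmon_def delta_mult)
qed

text \<open>Induction on a strict bound \<open>n + 1\<close> for the degree in \<open>x\<close>:
  either a scalar multiple of a monic \<open>bmon\<close> removes the coefficient of
  \<open>x^n\<close>, or no such monomial has degree \<open>n\<close> and that coefficient must
  vanish.\<close>

lemma delta_kernel_induct [consumes 4, case_names bmon add]:
  fixes f :: "'f::field base"
  assumes p: "prime p" "odd p" "CHAR('f) = p" and f: "delta f = 0"
    and mon: "\<And>c i e. P (bK c * bmon p i e)" and add: "\<And>f g. P f \<Longrightarrow> P g \<Longrightarrow> P (f + g)"
  shows "P f"
proof -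
  have delta_mon: "delta (bK c * bmon p i e) = (0 :: 'f base)" for c i e
    using delta_bmon[OF p(3), of i e] p(1) prime_gt_0_nat by (simp add: delta_mult)
  have "P f" if "\<And>k. k \<ge> n \<Longrightarrow> coeff f k = 0" "delta f = 0" for n and f :: "'f base"
    using that
  proof (induction n arbitrary: f)
    case 0
    then have "f = bK 0 * bmon p 0 0" by (simp add: poly_eqI)
    then show ?case using mon by metis
  next
    case (Suc n)
    let ?L = "\<lambda>k a. Poly_Mapping.lookup (coeff f k) a"
    have rel: "of_nat (Suc k) * ?L (Suc k) (a - 1) + (if k = 0 then 0 else to_ac a * ?L (k - 1) a) = 0"
      for k a
    proof -
      have "of_nat (Suc k) * ?L (Suc k) (a - 1) + (if k = 0 then 0 else to_ac a * ?L (k - 1) a)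
          = - Poly_Mapping.lookup (coeff (delta f) k) a"
        unfolding lookup_coeff_delta by (simp del: of_nat_Suc)
      then show ?thesis using Suc.prems(2) by simp
    qed
    define c where "c = ?L n 0"
    \<comment> \<open>In the recurrence at \<open>n + 1\<close> the coefficient of
      \<open>x^(n+2)\<close> is zero. So the entry \<open>a\<close> kills the coefficient of
      \<open>x^n\<close> at \<open>a\<close>, and only entry 0 survives.\<close>
    have lead: "coeff f n = Poly_Mapping.single 0 c"
    proof (rule poly_mapping_eqI)
      fix a
      have "to_ac a * ?L n a = 0" using rel[of "Suc n" a] Suc.prems(1) by simp
      then show "?L n a = Poly_Mapping.lookup (Poly_Mapping.single 0 c) a"
        by (auto simp: c_def lookup_single when_def)
    qed
    show ?case
    proof (cases "\<exists>i e. n = 2 * i + p * e")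
      case True
      then obtain i e where n: "n = 2 * i + p * e" by blast
      define g where "g = f - bK c * bmon p i e"
      have "P g"
      proof (rule Suc.IH)
        show "delta g = 0" using Suc.prems(2) delta_mon[of c i e] by (simp add: g_def)
        fix k assume k: "k \<ge> n"
        show "coeff g k = 0"
        proof (cases "k = n")
          case True
          then show ?thesis
            using bmon_top[of p i e, where ?'f = 'f] lead by (simp add: g_def bK_def n)
        next
          case False
          with k have "k > n" by simp
          then show ?thesis
            using bmon_top[of p i e, where ?'f = 'f] Suc.prems(1)
            by (simp add: g_def bK_def n coeff_eq_0)
        qed
      qed
      moreover have "f = g + bK c * bmon p i e" by (simp add: g_def)
      ultimately show ?thesis using mon add by metis
    next
      case False
      \<comment> \<open>An even \<open>n\<close> would be reached with \<open>e = 0\<close>, and an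
        odd \<open>n \<ge> p\<close> with \<open>e = 1\<close>.\<close>
      then have "odd n" by (metis add_cancel_right_right evenE mult_0_right)
      moreover have "n < p"
      proof (rule ccontr)
        assume "\<not> n < p"
        moreover from this have "even (n - p)" using \<open>odd n\<close> p(2) by simp
        ultimately have "n = 2 * ((n - p) div 2) + p * 1" by simp
        with False show False by blast
      qed
      ultimately obtain m where n: "n = 2 * m + 1" "2 * m + 1 < p" by (metis oddE)
      have "c = 0"
      proof (rule ccontr)
        assume c: "c \<noteq> 0"
        have nonzero: "of_nat k \<noteq> (0 :: 'f alg_closure)" if "0 < k" "k < p" for k
          using that by (auto simp: of_nat_eq_0_iff_char_dvd p(3) dest: dvd_imp_le)
        \<comment> \<open>The recurrence links \<open>x^(n-2j)\<close> at entry \<open>j\<close> to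
          \<open>x^(n-2j-2)\<close> at entry \<open>j + 1\<close>. The factor \<open>n - 2j\<close>
          lies between 0 and \<open>p\<close>, so it is nonzero in k and nonvanishing propagates
          downwards.\<close>
        have "?L (n - 2 * j) (of_nat j) \<noteq> 0" if "j \<le> m" for j
          using that
        proof (induction j)
          case 0
          show ?case using c by (simp add: c_def)
        next
          case (Suc j)
          then obtain d where "m = Suc j + d" using le_Suc_ex by blast
          with n have e: "n - 2 * j = Suc (2 * d + 2)" "n - 2 * Suc j = 2 * d + 2 - 1" "Suc (2 * d + 2) < p"
            by simp_all
          have "of_nat (Suc (2 * d + 2)) * ?L (n - 2 * j) (of_nat j)
              + to_ac (of_nat (Suc j)) * ?L (n - 2 * Suc j) (of_nat (Suc j)) = 0"
            unfolding e using rel[of "2 * d + 2" "of_nat (Suc j)"] by simp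
          moreover have "of_nat (Suc (2 * d + 2)) * ?L (n - 2 * j) (of_nat j) \<noteq> 0"
            using Suc nonzero[OF _ e(3)] by (simp del: of_nat_Suc)
          ultimately show ?case by auto
        qed
        \<comment> \<open>The chain ends at \<open>x^1\<close>, where the recurrence at
          \<open>k = 0\<close> has a single term and forces zero.\<close>
        from this[of m] have "?L 1 (of_nat m) \<noteq> 0" by (simp add: n)
        moreover have "?L 1 (of_nat m) = 0" using rel[of 0 "of_nat (Suc m)"] by simp
        ultimately show False by contradiction
      qed
      then show ?thesis
        using Suc.prems lead by (intro Suc.IH) (auto simp: le_Suc_eq Suc_le_eq dest: le_neq_implies_less)
    qed
  qed
  from this[of "Suc (degree f)" f] show ?thesis using f by (simp add: coeff_eq_0)
qed

section \<open>Division by C and the center\<close>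

definition ycentral :: "'f::field ore \<Rightarrow> bool" where
  "ycentral z \<longleftrightarrow> (\<forall>u. z * u = u * z)"

lemma ydeg_less_iff: "q > 0 \<Longrightarrow> ydeg u < q \<longleftrightarrow> (\<forall>k\<ge>q. ycoeff u k = 0)"
  unfolding ydeg_def ycoeff_def
  by (metis coeff_eq_0 degree_0 leading_coeff_0_iff linorder_not_le order_less_le_trans)

lemma ycoeff_simps [simp]: "ycoeff (u + v) n = ycoeff u n + ycoeff v n"
  "ycoeff (u - v) n = ycoeff u n - ycoeff v n" "ycoeff 0 n = 0"
  "ycoeff (ybase r * u) n = r * ycoeff u n"
  by (simp_all add: ycoeff_def)

text \<open>Division with the quotient on the left of the monic divisor. The alternative
  \<open>Q = 0\<close> covers \<open>N = 0\<close>, since zero has degree 0 by convention.\<close>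

lemma monic_division:
  fixes C :: "'f::field ore"
  assumes C: "ydeg C \<le> q" "ycoeff C q = 1" "q > 0"
    and "ydeg z < N + q"
  shows "\<exists>Q S. z = Q * C + S \<and> ydeg S < q \<and> (Q = 0 \<or> ydeg Q < N)"
  using assms(4)
proof (induction N arbitrary: z)
  case 0
  then show ?case by (intro exI[of _ 0] exI[of _ z]) simp
next
  case (Suc N)
  \<comment> \<open>The leading term of the quotient: \<open>m C\<close> has the same coefficient as
    \<open>z\<close> at degree \<open>N + q\<close>.\<close>
  define m where "m = Ore (monom (ycoeff z (N + q)) N)"
  have m: "ydeg m \<le> N" "ycoeff m N = ycoeff z (N + q)"
    by (simp_all add: m_def ydeg_def ycoeff_def Ore_inverse degree_monom_le)
  have "ydeg (z - m * C) < N + q"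
  proof (subst ydeg_less_iff, use C(3) in simp, intro allI impI)
    fix k assume k: "N + q \<le> k"
    show "ycoeff (z - m * C) k = 0"
    proof (cases "k = N + q")
      case True
      then show ?thesis using ycoeff_mult_top[OF m(1) C(1)] m(2) C(2) by simp
    next
      case False
      with k have "k > N + q" by simp
      then show ?thesis
        using ydeg_mult_le[OF m(1) C(1)] Suc.prems by (simp add: ycoeff_def ydeg_def coeff_eq_0)
    qed
  qed
  from Suc.IH[OF this] obtain Q S
    where QS: "z - m * C = Q * C + S" "ydeg S < q" "Q = 0 \<or> ydeg Q < N" by blast
  have "z = (Q + m) * C + S" using QS(1) by (simp add: algebra_simps)
  moreover have "ydeg (Q + m) < Suc N"
    using QS(3) m(1) by (auto simp: ydeg_def less_Suc_eq_le intro!: degree_add_le)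
  ultimately show ?case using QS(2) by blast
qed

text \<open>For a generator \<open>w\<close>, the commutator \<open>T\<close> of \<open>w\<close>
  with \<open>Q\<close> satisfies \<open>T C = - (w S - S w)\<close>. The right side has degree
  below q, whereas a nonzero \<open>T\<close> times the monic \<open>C\<close> has degree at least
  q.\<close>

lemma monic_division_central:
  fixes C :: "'f::field ore"
  assumes C: "ydeg C \<le> q" "ycoeff C q = 1" "q > 0" "ycentral C"
    and z: "ycentral z" "z = Q * C + S" "ydeg S < q"
  shows "ycentral Q \<and> ycentral S"
proof -
  have comm: "w * Q = Q * w \<and> w * S = S * w" if w: "ydeg (w * S - S * w) < q" for w
  proof -
    define T where "T = w * Q - Q * w"
    have "w * z = z * w" using z(1) by (simp add: ycentral_def)
    then have "w * (Q * C) + w * S = Q * (w * C) + S * w"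
      using C(4) by (simp add: z(2) algebra_simps ycentral_def)
    then have TC: "T * C = - (w * S - S * w)"
      by (simp add: T_def algebra_simps)
    have "T = 0"
    proof (rule ccontr)
      assume "T \<noteq> 0"
      then have "ycoeff T (ydeg T) \<noteq> 0"
        by (simp add: ycoeff_def ydeg_def ypoly_inject_iff)
      then have "ycoeff (T * C) (ydeg T + q) \<noteq> 0"
        using ycoeff_mult_top[of T "ydeg T", OF _ C(1)] C(2) by simp
      moreover have "ydeg (T * C) < q"
        unfolding TC ydeg_def ypoly_simps(5) degree_minus using w by (simp only: ydeg_def)
      ultimately show False by (simp add: ycoeff_def ydeg_def coeff_eq_0)
    qed
    with TC show ?thesis by (simp add: T_def)
  qed
  have base: "ydeg (ybase r * S - S * ybase r) < q" for r
    using ydeg_mult_le[of "ybase r" 0 S "ydeg S"] ydeg_mult_le[of S "ydeg S" "ybase r" 0] z(3)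
    by (auto simp: ydeg_def intro!: le_less_trans[OF degree_diff_le])
  \<comment> \<open>The shifts in \<open>y S\<close> and \<open>S y\<close> cancel; what is left is
    \<open>delta\<close> applied to the coefficients of \<open>S\<close>.\<close>
  have Y: "ydeg (oY * S - S * oY) < q"
    using z(3) unfolding ydeg_less_iff[OF C(3)]
    by (auto simp: ycoeff_def coeff_ydel coeff_pCons split: nat.split)
  show ?thesis
    unfolding ycentral_def
    by (rule conjI; rule allI; rule ore_centralI; simp only: comm[OF base] comm[OF Y])
qed

lemma center_induct [consumes 8, case_names mon add]:
  fixes \<xi> :: "'f::{field,finite}"
  assumes z: "ycentral z" and hyps: "prime p" "odd p" "r > 0" "CARD('f) = p ^ r"
    and gen: "range (\<lambda>n::int. \<xi> powi n) = UNIV - {0}"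
    and zs: "set zs = Xi \<xi> r" "distinct zs"
    and mon: "\<And>c i e m. P (oK c * ybase (bmon p i e) * oC p zs ^ m)"
    and add: "\<And>u v. P u \<Longrightarrow> P v \<Longrightarrow> P (u + v)"
  shows "P z"
proof -
  let ?C = "oC p zs"
  have char: "CHAR('f) = p" using hyps(1,4) by (rule CHAR_eq_of_CARD_prime_power)
  define q where "q = CARD('f)"
  have q: "p * length zs = q"
    using card_Xi[OF hyps(1,4) gen hyps(3)] zs by (metis distinct_card q_def)
  have q0: "q > 0" by (simp add: q_def)
  have C: "ydeg ?C \<le> q" "ycoeff ?C q = 1" "ycentral ?C"
    using oC_top[of p zs] oC_central[OF hyps gen zs] by (simp_all add: q ycentral_def)
  have low: "P (u * ?C ^ m)" if u: "ycentral u" "ydeg u < q" for u m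
  proof -
    have "ydeg u = 0" using u by (intro central_low_degree) (simp_all add: ycentral_def q_def)
    then obtain f where f: "ypoly u = [:f:]" by (auto simp: ydeg_def elim: degree_eq_zeroE)
    then have uf: "u = ybase f" by (simp add: ypoly_inject_iff)
    have "delta f = 0"
      using delta_coeff_of_commute[of u 0] u(1) f by (simp add: ycentral_def ycoeff_def)
    from hyps(1,2) char this have "P (ybase f * ?C ^ m)"
      by (induction f rule: delta_kernel_induct) (use mon add in \<open>simp_all add: distrib_right\<close>)
    then show ?thesis by (simp add: uf)
  qed
  \<comment> \<open>The power of \<open>C\<close> is carried along because dividing \<open>u\<close>
    by \<open>C\<close> turns \<open>u C^m\<close> into \<open>Q C^(m+1) + S C^m\<close>.\<close>
  have "P (u * ?C ^ m)" if "ycentral u" for u m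
    using that
  proof (induction "ydeg u" arbitrary: u m rule: less_induct)
    case less
    show ?case
    proof (cases "ydeg u < q")
      case True
      then show ?thesis using low less.prems by simp
    next
      case False
      define N where "N = Suc (ydeg u - q)"
      have "ydeg u < N + q" using False by (simp add: N_def)
      from monic_division[OF C(1,2) q0 this] obtain Q S
        where QS: "u = Q * ?C + S" "ydeg S < q" "Q = 0 \<or> ydeg Q < N" by blast
      have cent: "ycentral Q" "ycentral S"
        using monic_division_central[OF C(1,2) q0 C(3) less.prems QS(1,2)] by simp_all
      \<comment> \<open>If \<open>Q = 0\<close>, its degree 0 is still below
        \<open>ydeg u \<ge> q > 0\<close>.\<close>
      have "ydeg Q < ydeg u"
        using QS(3) False q0 by (auto simp: N_def ydeg_def)
      from less.hyps[OF this cent(1)] have "P (Q * ?C ^ Suc m)" .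
      moreover have "P (S * ?C ^ m)" using low cent(2) QS(2) by simp
      moreover have "u * ?C ^ m = Q * ?C ^ Suc m + S * ?C ^ m"
        by (simp add: QS(1) distrib_right mult.assoc)
      ultimately show ?thesis using add by metis
    qed
  qed
  from this[of z 0] z show ?thesis by simp
qed

section \<open>The presentation of the center\<close>

lemma bmon_add: "bmon p (i + j) (e + f) = bmon p i e * bmon p j f"
  by (simp add: bmon_def power_add algebra_simps)

lemma CHAR_grp_alg [simp]: "CHAR('f::field grp_alg) = CHAR('f)"
proof (rule CHAR_eqI)
  fix n assume "of_nat n = (0 :: 'f grp_alg)"
  then have "Poly_Mapping.single 0 (of_nat n) = (0 :: 'f grp_alg)" by simp
  then have "of_nat n = (0 :: 'f alg_closure)"
    by (metis lookup_single_eq lookup_zero)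
  then show "CHAR('f) dvd n" by (simp add: of_nat_eq_0_iff_char_dvd)
next
  have "of_nat CHAR('f) = (0 :: 'f alg_closure)" by (simp add: of_nat_eq_0_iff_char_dvd)
  then show "of_nat CHAR('f) = (0 :: 'f grp_alg)"
    by (metis single_of_nat single_zero)
qed

text \<open>Here \<open>A = x^2 - 2 (g_1 - 1)\<close>, and Frobenius gives
  \<open>(g_1 - 1)^p = g_1^p - 1 = 0\<close> because \<open>g_1^p\<close> has entry
  \<open>p = 0\<close>.\<close>

lemma bA_power_CHAR:
  assumes "CHAR('f::field) = p" "prime p" "odd p"
  shows "bA ^ p = ((bX ^ p) ^ 2 :: 'f base)"
proof -
  have frob: "(f + g) ^ p = f ^ p + g ^ p" for f g :: "'f base"
    by (rule freshmans_dream) (simp_all add: assms)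
  have "(bG 1 + (-1)) ^ p = (bG 1 :: 'f base) ^ p - 1"
    unfolding frob using assms(3) by simp
  also have "(bG 1 :: 'f base) ^ n = bG (of_nat n)" for n
    by (induction n) (simp_all add: bG_simps)
  then have "(bG 1 :: 'f base) ^ p = 1"
    using assms(1) of_nat_CHAR[where ?'a = 'f] by (simp add: bG_simps)
  finally have 0: "(bG 1 + (-1)) ^ p = (0 :: 'f base)" by simp
  have bA: "bA = bX ^ 2 + (-2) * (bG 1 + (-1) :: 'f base)"
    by (simp add: bA_def algebra_simps del: mult_pCons_left mult_pCons_right)
  have "bA ^ p = (bX ^ 2) ^ p + ((-2) * (bG 1 + (-1) :: 'f base)) ^ p"
    unfolding bA by (rule frob)
  also have "\<dots> = (bX ^ 2) ^ p"
    using 0 unfolding power_mult_distrib by simp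
  finally show ?thesis by (simp only: mult.commute flip: power_mult)
qed

lemma ycentral_ybase: "delta f = 0 \<Longrightarrow> ycentral (ybase f)"
  unfolding ycentral_def by (intro allI; rule ore_centralI) (simp_all only: ybase_commute oY_ybase, simp)

lemma ycentral_mult: "ycentral u \<Longrightarrow> ycentral v \<Longrightarrow> ycentral (u * v)"
  unfolding ycentral_def by (metis mult.assoc)

lemma ycentral_power: "ycentral u \<Longrightarrow> ycentral (u ^ n)"
  by (induction n) (simp_all add: ycentral_mult, simp add: ycentral_def)

section \<open>The map from the polynomial ring to the Ore extension\<close>

definition omon :: "nat \<Rightarrow> 'f::field list \<Rightarrow> (var \<Rightarrow>\<^sub>0 nat) \<Rightarrow> 'f ore" where
  "omon p zs k = ybase (bmon p (Poly_Mapping.lookup k VA) (Poly_Mapping.lookup k VB))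
     * oC p zs ^ Poly_Mapping.lookup k VC"

definition center_map :: "nat \<Rightarrow> 'f::field list \<Rightarrow> 'f poly3 \<Rightarrow> 'f ore" where
  "center_map p zs f = (\<Sum>k\<in>Poly_Mapping.keys f. oK (Poly_Mapping.lookup f k) * omon p zs k)"

lemma center_map_0 [simp]: "center_map p zs 0 = 0"
  by (simp add: center_map_def)

lemma center_map_single: "center_map p zs (Poly_Mapping.single k c) = oK c * omon p zs k"
  by (cases "c = 0") (simp_all add: center_map_def)

lemma center_map_add: "center_map p zs (f + g) = center_map p zs f + center_map p zs g"
  unfolding center_map_def
  by (rule setsum_keys_plus_distrib) (simp_all add: distrib_right)

section \<open>Normal forms modulo the relation\<close>

lemma rel_ideal_eq: "rel_ideal p = {g * (pvar VA ^ p - pvar VB ^ 2) |g. True}"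
proof -
  interpret cring "poly3_ring :: 'a poly3 ring"
    unfolding poly3_ring_def by (rule comm_ring_1_class.cring_from_type_algebra)
  have "rel_ideal p = PIdl\<^bsub>poly3_ring\<^esub> (pvar VA ^ p - pvar VB ^ 2 :: 'a poly3)"
    unfolding rel_ideal_def
    by (rule cgenideal_eq_genideal[symmetric]) (simp add: poly3_ring_def ring_of_type_algebra_def)
  then show ?thesis
    by (simp add: cgenideal_def poly3_ring_def ring_of_type_algebra_def)
qed

lemma pvar_power: "pvar v ^ n = Poly_Mapping.single (Poly_Mapping.single v n) 1"
proof (induction n)
  case (Suc n)
  then show ?case by (simp add: pvar_def mult_single flip: single_add)
qed simp

lemma rel_ideal_normal_form:
  "\<exists>n g. f = n + g * (pvar VA ^ p - pvar VB ^ 2) \<and> (\<forall>k\<in>Poly_Mapping.keys n. Poly_Mapping.lookup k VB \<le> 1)"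
proof (induction f rule: pm_induct)
  case zero
  show ?case by (intro exI[of _ 0]) simp
next
  case (single k c)
  show ?case
  proof (induction "Poly_Mapping.lookup k VB" arbitrary: k rule: less_induct)
    case less
    let ?rel = "pvar VA ^ p - pvar VB ^ 2 :: 'a poly3"
    show ?case
    proof (cases "Poly_Mapping.lookup k VB \<le> 1")
      case True
      then show ?thesis
        by (intro exI[of _ "Poly_Mapping.single k c"] exI[of _ 0]) simp
    next
      case False
      \<comment> \<open>Trading \<open>B^2\<close> for \<open>A^p\<close> lowers the exponent of
        \<open>B\<close> by two and costs a multiple of the relation.\<close>
      define l where "l = k - Poly_Mapping.single VB 2"
      have k: "k = l + Poly_Mapping.single VB 2"
        using False by (intro poly_mapping_eqI) (auto simp: l_def lookup_add lookup_minus lookup_single when_def)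
      have "Poly_Mapping.lookup (l + Poly_Mapping.single VA p) VB < Poly_Mapping.lookup k VB"
        by (simp add: k lookup_add lookup_single)
      from less[OF this] obtain n g
        where n: "Poly_Mapping.single (l + Poly_Mapping.single VA p) c = n + g * ?rel"
          "\<forall>k\<in>Poly_Mapping.keys n. Poly_Mapping.lookup k VB \<le> 1" by blast
      have "Poly_Mapping.single k c = Poly_Mapping.single (l + Poly_Mapping.single VA p) c
          - Poly_Mapping.single l c * ?rel"
        by (simp add: k pvar_power right_diff_distrib mult_single)
      also have "\<dots> = n + (g - Poly_Mapping.single l c) * ?rel"
        unfolding n by (simp add: algebra_simps)
      finally show ?thesis using n(2) by blast
    qed
  qed
next
  case (add a b)
  then obtain n g m h where
    eqs: "a = n + g * (pvar VA ^ p - pvar VB ^ 2)" "b = m + h * (pvar VA ^ p - pvar VB ^ 2)"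
    and keys: "\<forall>k\<in>Poly_Mapping.keys n. Poly_Mapping.lookup k VB \<le> 1"
      "\<forall>k\<in>Poly_Mapping.keys m. Poly_Mapping.lookup k VB \<le> 1" by blast
  have "a + b = (n + m) + (g + h) * (pvar VA ^ p - pvar VB ^ 2)"
    by (simp only: eqs distrib_right ac_simps)
  moreover have "\<forall>k\<in>Poly_Mapping.keys (n + m). Poly_Mapping.lookup k VB \<le> 1"
    using keys Poly_Mapping.keys_add[of n m] by blast
  ultimately show ?case by blast
qed

section \<open>Image and kernel of the map\<close>

context
  fixes p r :: nat and \<xi> :: "'f::{field,finite}" and zs :: "'f list"
  assumes p: "prime p" "odd p" and r: "r > 0" and card: "CARD('f) = p ^ r"
    and gen: "range (\<lambda>n::int. \<xi> powi n) = UNIV - {0}"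
    and zs: "set zs = Xi \<xi> r" "distinct zs"
begin

lemma CHAR_eq: "CHAR('f) = p"
  using p(1) card by (rule CHAR_eq_of_CARD_prime_power)

lemma ycentral_oC: "ycentral (oC p zs)"
  using oC_central[OF p r card gen zs] by (simp add: ycentral_def)

lemma ycentral_bmon: "ycentral (ybase (bmon p i e :: 'f base))"
  using delta_bmon[OF CHAR_eq] p(1) prime_gt_0_nat by (intro ycentral_ybase) auto

lemma ycentral_omon: "ycentral (omon p zs k)"
  unfolding omon_def by (intro ycentral_mult ycentral_bmon ycentral_power ycentral_oC)

lemma omon_add: "omon p zs (k + l) = omon p zs k * omon p zs l"
proof -
  let ?m = "\<lambda>k. ybase (bmon p (Poly_Mapping.lookup k VA) (Poly_Mapping.lookup k VB) :: 'f base)"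
  let ?c = "\<lambda>k :: var \<Rightarrow>\<^sub>0 nat. oC p zs ^ Poly_Mapping.lookup k VC"
  have "omon p zs (k + l) = ?m k * (?m l * ?c k) * ?c l"
    by (simp add: omon_def lookup_add bmon_add power_add mult.assoc)
  also have "?m l * ?c k = ?c k * ?m l"
    using ycentral_power[OF ycentral_oC] by (simp add: ycentral_def)
  finally show ?thesis by (simp add: omon_def mult.assoc)
qed

lemma center_map_mult: "center_map p zs (f * g) = center_map p zs f * center_map p zs g"
proof (induction f rule: pm_induct)
  case (single k c)
  show ?case
  proof (induction g rule: pm_induct)
    case (single l d)
    have "oK c * omon p zs k * (oK d * omon p zs l) = oK c * (omon p zs k * oK d) * omon p zs l"
      by (simp only: mult.assoc)
    also have "omon p zs k * oK d = oK d * omon p zs k" by (rule oK_commute[symmetric])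
    finally show ?case
      by (simp add: mult_single center_map_single omon_add mult.assoc)
  qed (simp_all add: distrib_left center_map_add)
qed (simp_all add: distrib_right center_map_add)

lemma center_map_pconst: "center_map p zs (pconst c) = oK c"
  by (simp add: pconst_def center_map_single omon_def bmon_def)

lemma center_map_1: "center_map p zs 1 = 1"
  using center_map_pconst[of 1] by (simp add: pconst_def)

lemma center_map_pvar:
  "center_map p zs (pvar VA) = ybase bA" "center_map p zs (pvar VB) = oX ^ p"
  "center_map p zs (pvar VC) = oC p zs"
  by (simp_all add: pvar_def center_map_single omon_def bmon_def lookup_single flip: ybase_power)

lemma center_map_power: "center_map p zs (f ^ n) = center_map p zs f ^ n"
  by (induction n) (simp_all add: center_map_1 center_map_mult)

lemma center_map_diff: "center_map p zs (f - g) = center_map p zs f - center_map p zs g"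
  using center_map_add[of p zs "f - g" g] by simp

lemma range_center_map: "range (center_map p zs) = {z. \<forall>u. z * u = u * z}"
proof (intro equalityI subsetI)
  fix z assume "z \<in> range (center_map p zs)"
  then obtain f where z: "z = center_map p zs f" by blast
  have "ycentral (center_map p zs f)"
  proof (induction f rule: pm_induct)
    case (single k c)
    show ?case unfolding center_map_single
      by (intro ycentral_mult ycentral_omon) (simp add: ycentral_def oK_commute)
  qed (simp_all add: center_map_add, simp_all add: ycentral_def algebra_simps)
  then show "z \<in> {z. \<forall>u. z * u = u * z}" by (simp add: z ycentral_def)
next
  fix z :: "'f ore" assume "z \<in> {z. \<forall>u. z * u = u * z}"
  then have "ycentral z" by (simp add: ycentral_def)
  from this p r card gen zs show "z \<in> range (center_map p zs)"
  proof (induction z rule: center_induct)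
    case (mon c i e m)
    have "center_map p zs (Poly_Mapping.single (Poly_Mapping.single VA i + Poly_Mapping.single VB e
        + Poly_Mapping.single VC m) c) = oK c * ybase (bmon p i e) * oC p zs ^ m"
      by (simp add: center_map_single omon_def lookup_add lookup_single mult.assoc)
    then show ?case by (metis rangeI)
  next
    case (add u v)
    then show ?case by (auto simp flip: center_map_add)
  qed
qed

lemma center_map_rel: "center_map p zs (pvar VA ^ p - pvar VB ^ 2) = 0"
proof -
  have "center_map p zs (pvar VA ^ p - pvar VB ^ 2) = ybase (bA ^ p - (bX ^ p) ^ 2)"
    by (simp add: center_map_diff center_map_power center_map_pvar)
  then show ?thesis using bA_power_CHAR[OF CHAR_eq p] by simp
qed

text \<open>A leading-term argument: monomials are compared first by the exponent of
  \<open>C\<close>, then by the degree \<open>?w\<close> in \<open>x\<close> of their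
  \<open>A\<close>-\<open>B\<close> part. The coefficient of the largest one can be read off from
  the image.\<close>

lemma center_map_inj_normal:
  assumes n: "\<And>k. k \<in> Poly_Mapping.keys n \<Longrightarrow> Poly_Mapping.lookup k VB \<le> 1"
    and "center_map p zs n = 0"
  shows "n = 0"
proof (rule ccontr)
  assume "n \<noteq> 0"
  let ?K = "Poly_Mapping.keys n"
  let ?w = "\<lambda>k :: var \<Rightarrow>\<^sub>0 nat. 2 * Poly_Mapping.lookup k VA + p * Poly_Mapping.lookup k VB"
  define M where "M = Max ((\<lambda>k. Poly_Mapping.lookup k VC) ` ?K)"
  have K: "?K \<noteq> {}" using \<open>n \<noteq> 0\<close> by (metis lookup_zero not_in_keys_iff_lookup_eq_zero poly_mapping_eqI empty_iff)
  have le_M: "Poly_Mapping.lookup k VC \<le> M" if "k \<in> ?K" for k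
    using that by (simp add: M_def)
  define L where "L = {k \<in> ?K. Poly_Mapping.lookup k VC = M}"
  have "M \<in> (\<lambda>k. Poly_Mapping.lookup k VC) ` ?K"
    unfolding M_def using K by (intro Max_in) auto
  then have "L \<noteq> {}" "finite L" by (auto simp: L_def)
  then have "Max (?w ` L) \<in> ?w ` L" by (intro Max_in) auto
  then obtain k0 where k0: "k0 \<in> L" "?w k0 = Max (?w ` L)" by auto
  have le_w: "?w k \<le> ?w k0" if "k \<in> L" for k
    using that \<open>finite L\<close> by (simp add: k0(2))
  \<comment> \<open>As \<open>p\<close> is odd, the parity of the weight is that of the exponent of
    \<open>B\<close>. With exponents at most 1 this determines the exponent of \<open>B\<close>, and
    the weight then gives that of \<open>A\<close>.\<close>
  have eq_k0: "k = k0" if k: "k \<in> L" "?w k = ?w k0" for k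
  proof -
    have le: "Poly_Mapping.lookup k VB \<le> 1" "Poly_Mapping.lookup k0 VB \<le> 1"
      using n k(1) k0(1) by (auto simp: L_def)
    have "even (?w k) \<longleftrightarrow> even (?w k0)" using k(2) by simp
    then have "even (Poly_Mapping.lookup k VB) \<longleftrightarrow> even (Poly_Mapping.lookup k0 VB)"
      using p(2) by simp
    with le have B: "Poly_Mapping.lookup k VB = Poly_Mapping.lookup k0 VB"
      by (auto simp: le_Suc_eq)
    show ?thesis
    proof (rule poly_mapping_eqI)
      show "Poly_Mapping.lookup k v = Poly_Mapping.lookup k0 v" for v
        using B k k0(1) by (cases v) (auto simp: L_def)
    qed
  qed
  define q where "q = p * length zs"
  have q0: "q > 0"
    using card_Xi[OF p(1) card gen r] zs distinct_card[OF zs(2)] zero_less_card_finite[where 'a = 'f]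
    by (metis q_def)
  have C_pow: "ydeg (oC p zs ^ m) \<le> q * m \<and> ycoeff (oC p zs ^ m) (q * m) = 1" for m
    using prod_list_top[of "replicate m (oC p zs)" q] oC_top[of p zs]
    by (auto simp: q_def prod_list_replicate)
  \<comment> \<open>The coefficient of the identity group element at \<open>x\<close>-degree
    \<open>?w k0\<close> and \<open>y\<close>-degree \<open>q M\<close>.\<close>
  define h where "h = (\<lambda>u :: 'f ore. Poly_Mapping.lookup (coeff (ycoeff u (q * M)) (?w k0)) 0)"
  \<comment> \<open>A smaller power of \<open>C\<close> does not reach degree \<open>q M\<close> in
    \<open>y\<close>; with the same power, a smaller weight does not reach degree
    \<open>?w k0\<close> in \<open>x\<close>.\<close>
  have h_mon: "h (oK c * omon p zs k) = (if k = k0 then c else 0)" if k: "k \<in> ?K" for k c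
  proof (cases "k \<in> L")
    case False
    then have "Poly_Mapping.lookup k VC < M" using le_M k by (force simp: L_def)
    then have "q * Poly_Mapping.lookup k VC < q * M" using q0 by simp
    then have "ycoeff (oC p zs ^ Poly_Mapping.lookup k VC) (q * M) = 0"
      using C_pow[of "Poly_Mapping.lookup k VC"] unfolding ycoeff_def ydeg_def
      by (intro coeff_eq_0) linarith
    then show ?thesis using False k0(1) by (auto simp: h_def omon_def)
  next
    case True
    let ?b = "bmon p (Poly_Mapping.lookup k VA) (Poly_Mapping.lookup k VB) :: 'f base"
    have "ycoeff (oC p zs ^ Poly_Mapping.lookup k VC) (q * M) = 1"
      using C_pow[of M] True by (simp add: L_def)
    then have h: "h (oK c * omon p zs k) = Poly_Mapping.lookup (Poly_Mapping.single 0 c * coeff ?b (?w k0)) 0"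
      by (simp add: h_def omon_def bK_def)
    show ?thesis
    proof (cases "k = k0")
      case True
      then have "coeff ?b (?w k0) = 1"
        using bmon_top[of p "Poly_Mapping.lookup k VA" "Poly_Mapping.lookup k VB", where ?'f = 'f] by simp
      then show ?thesis unfolding h using True by simp
    next
      case False
      then have "?w k < ?w k0" using le_w[OF True] eq_k0[OF True] by linarith
      then have "coeff ?b (?w k0) = 0"
        using bmon_top[of p "Poly_Mapping.lookup k VA" "Poly_Mapping.lookup k VB", where ?'f = 'f]
        by (intro coeff_eq_0) linarith
      then show ?thesis using False by (simp add: h)
    qed
  qed
  have h_sum: "h (sum f A) = (\<Sum>k\<in>A. h (f k))" for f and A :: "(var \<Rightarrow>\<^sub>0 nat) set"
    by (induction A rule: infinite_finite_induct) (simp_all add: h_def lookup_add)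
  have "h (center_map p zs n) = (\<Sum>k\<in>?K. if k = k0 then Poly_Mapping.lookup n k else 0)"
    unfolding center_map_def h_sum by (intro sum.cong refl h_mon)
  also have "\<dots> = Poly_Mapping.lookup n k0"
    using k0(1) by (simp add: L_def)
  finally have "Poly_Mapping.lookup n k0 = 0" using assms(2) by (simp add: h_def)
  then show False using k0(1) by (simp add: L_def in_keys_iff)
qed

lemma kernel_center_map: "rel_ideal p = {f. center_map p zs f = 0}"
proof (intro equalityI subsetI)
  fix f :: "'f poly3" assume "f \<in> rel_ideal p"
  then show "f \<in> {f. center_map p zs f = 0}"
    by (auto simp: rel_ideal_eq center_map_mult center_map_rel)
next
  fix f :: "'f poly3" assume f: "f \<in> {f. center_map p zs f = 0}"
  obtain n g where ng: "f = n + g * (pvar VA ^ p - pvar VB ^ 2)"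
    "\<forall>k\<in>Poly_Mapping.keys n. Poly_Mapping.lookup k VB \<le> 1"
    using rel_ideal_normal_form by blast
  have "center_map p zs n = 0"
    using f by (simp add: ng(1) center_map_add center_map_mult center_map_rel)
  then have "n = 0" using ng(2) center_map_inj_normal by blast
  then show "f \<in> rel_ideal p" using ng(1) by (auto simp: rel_ideal_eq)
qed

end

section \<open>The smash product and the Ore extension\<close>

definition ogen :: "gen \<Rightarrow> 'f::field ore" where
  "ogen i = (case i of GX \<Rightarrow> oX | GY \<Rightarrow> oY)"

definition free_to_ore :: "'f::field free_alg \<Rightarrow> 'f ore" where
  "free_to_ore u = (\<Sum>w\<in>Poly_Mapping.keys u.
     oK (Poly_Mapping.lookup u w) * prod_list (map ogen (letters w)))"

lemma free_to_ore_0 [simp]: "free_to_ore 0 = 0"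
  by (simp add: free_to_ore_def)

lemma free_to_ore_single [simp]:
  "free_to_ore (Poly_Mapping.single w c) = oK c * prod_list (map ogen (letters w))"
  by (cases "c = 0") (simp_all add: free_to_ore_def)

lemma free_to_ore_add [simp]: "free_to_ore (u + v) = free_to_ore u + free_to_ore v"
  unfolding free_to_ore_def
  by (rule setsum_keys_plus_distrib) (simp_all add: distrib_right)

lemma free_to_ore_mult [simp]: "free_to_ore (u * v) = free_to_ore u * free_to_ore v"
proof (induction u rule: pm_induct)
  case (single w c)
  show ?case
  proof (induction v rule: pm_induct)
    case (single w' c')
    show ?case
      by (simp add: mult_single mult.assoc) (metis oK_commute mult.assoc)
  qed (simp_all add: distrib_left)
qed (simp_all add: distrib_right)

lemma free_to_ore_fconst [simp]: "free_to_ore (fconst c) = oK c"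
  by (simp add: fconst_def)

lemma free_to_ore_1 [simp]: "free_to_ore 1 = 1"
  using free_to_ore_fconst[of 1] by (simp add: fconst_simps)

lemma free_to_ore_fgen [simp]: "free_to_ore (fgen i) = ogen i"
  by (simp add: fgen_def)

text \<open>The smash relation \<open>g v = (g.v) g\<close> holds in the Ore extension: on
  generators by \<open>oG_oY\<close>, and then along words. It makes \<open>smash_to_ore\<close>
  multiplicative.\<close>

lemma free_to_ore_act: "oG (entry g) * free_to_ore v = free_to_ore (act g v) * oG (entry g)"
proof (induction v rule: pm_induct)
  case (single w c)
  have gen: "oG (entry g) * ogen i = free_to_ore (act g (fgen i)) * oG (entry g)" for i
    by (cases i) (simp_all add: ogen_def act_fgen oG_oY ybase_commute)
  have "oG (entry g) * prod_list (map ogen is) =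
      free_to_ore (act g (prod_list (map fgen is))) * oG (entry g)" for "is"
  proof (induction "is")
    case (Cons i "is")
    let ?e = "oG (entry g)" and ?F = "\<lambda>u. free_to_ore (act g u)"
    have "?e * prod_list (map ogen (i # is)) = (?e * ogen i) * prod_list (map ogen is)"
      by (simp add: mult.assoc)
    also have "\<dots> = ?F (fgen i) * (?e * prod_list (map ogen is))"
      by (simp only: gen mult.assoc)
    also have "\<dots> = ?F (prod_list (map fgen (i # is))) * ?e"
      by (simp add: Cons.IH mult.assoc)
    finally show ?case .
  qed simp
  then have "oG (entry g) * (oK c * prod_list (map ogen (letters w))) =
      oK c * (free_to_ore (act g (prod_list (map fgen (letters w)))) * oG (entry g))"
    by (metis oK_commute mult.assoc)
  moreover have "Poly_Mapping.single w c = fconst c * prod_list (map fgen (letters w))"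
    by (simp add: prod_list_fgen fconst_def mult_single)
  moreover have "act g (fconst c) = fconst c"
    by (simp add: act_def)
  moreover have "free_to_ore (Poly_Mapping.single w c) = oK c * prod_list (map ogen (letters w))"
    by simp
  ultimately show ?case
    by (simp only: act_simps free_to_ore_mult free_to_ore_fconst mult.assoc)
qed (simp_all add: distrib_left distrib_right)

definition smash_to_ore :: "'f::field smash \<Rightarrow> 'f ore" where
  "smash_to_ore u = (\<Sum>g\<in>Poly_Mapping.keys (Rep_smash u).
     free_to_ore (Poly_Mapping.lookup (Rep_smash u) g) * oG (entry g))"

lemma smash_to_ore_0 [simp]: "smash_to_ore 0 = 0"
  by (simp add: smash_to_ore_def zero_smash.rep_eq)

lemma smash_to_ore_elt [simp]: "smash_to_ore (smash_elt u g) = free_to_ore u * oG (entry g)"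
  by (cases "u = 0") (simp_all add: smash_to_ore_def smash_elt_def Abs_smash_inverse)

lemma smash_to_ore_add [simp]: "smash_to_ore (u + v) = smash_to_ore u + smash_to_ore v"
  unfolding smash_to_ore_def plus_smash.rep_eq
  by (rule setsum_keys_plus_distrib) (simp_all add: distrib_right)

lemma smash_induct [case_names zero elt add]:
  assumes "P 0" "\<And>w c g. P (smash_elt (Poly_Mapping.single w c) g)"
    "\<And>u v. P u \<Longrightarrow> P v \<Longrightarrow> P (u + v)"
  shows "P (u :: 'f::field smash)"
proof -
  have Abs_add: "Abs_smash (F + G) = Abs_smash F + (Abs_smash G :: 'f smash)" for F G
    by (simp add: plus_smash.abs_eq)
  have "P (Abs_smash F)" for F
  proof (induction F rule: pm_induct)
    case zero
    show ?case using assms(1) by (simp add: zero_smash_def)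
  next
    case (single g v)
    show ?case
    proof (induction v rule: pm_induct)
      case zero
      show ?case using assms(1) by (simp add: zero_smash_def)
    next
      case (single w c)
      show ?case using assms(2) by (simp add: smash_elt_def)
    next
      case (add a b)
      then show ?case using assms(3) by (simp add: single_add Abs_add)
    qed
  next
    case (add a b)
    then show ?case using assms(3) by (simp add: Abs_add)
  qed
  then show ?thesis by (metis Rep_smash_inverse)
qed

lemma smash_to_ore_mult [simp]: "smash_to_ore (u * v) = smash_to_ore u * smash_to_ore v"
proof (induction u rule: smash_induct)
  case (elt w c g)
  show ?case
  proof (induction v rule: smash_induct)
    case (elt w' c' h)
    let ?u = "Poly_Mapping.single w c" and ?v = "Poly_Mapping.single w' c'"
    have "smash_to_ore (smash_elt ?u g * smash_elt ?v h) =
        free_to_ore ?u * (free_to_ore (act g ?v) * oG (entry g)) * oG (entry h)"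
      by (simp add: smash_elt_mult bG_simps mult.assoc del: free_to_ore_single)
    also have "\<dots> = smash_to_ore (smash_elt ?u g) * smash_to_ore (smash_elt ?v h)"
      unfolding free_to_ore_act[symmetric] by (simp add: mult.assoc del: free_to_ore_single)
    finally show ?case .
  qed (simp_all add: distrib_left)
qed (simp_all add: distrib_right)

lemma one_smash_elt: "1 = smash_elt 1 1"
  by (simp add: smash_elt_def one_smash_def)

lemma smash_to_ore_1 [simp]: "smash_to_ore 1 = 1"
  by (simp add: one_smash_elt)

lemma smash_to_ore_diff [simp]: "smash_to_ore (u - v) = smash_to_ore u - smash_to_ore v"
  using smash_to_ore_add[of "u - v" v] by simp

lemma smash_to_ore_simps [simp]:
  "smash_to_ore sx = oX" "smash_to_ore sy = oY" "smash_to_ore (sconst c) = oK c"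
  "smash_to_ore (sgrp g) = oG (entry g)"
  by (simp_all add: sx_def sy_def sconst_def sgrp_def ogen_def)

lemma surj_smash_to_ore: "surj smash_to_ore"
proof -
  have "\<exists>u. z = smash_to_ore u" for z :: "'a ore"
  proof (induction z rule: ore_induct)
    case (base r)
    show ?case
    proof (induction r rule: base_induct)
      case (const c)
      show ?case by (metis smash_to_ore_simps(3))
    next
      case (grp a)
      show ?case by (metis smash_to_ore_simps(4) entry_unip_elt)
    next
      case var
      show ?case by (metis smash_to_ore_simps(1))
    next
      case (add r s)
      then show ?case by (metis smash_to_ore_add ybase_simps(3))
    next
      case (mult r s)
      then show ?case by (metis smash_to_ore_mult ybase_simps(4))
    qed
  next
    case (add u v)
    then show ?case by (metis smash_to_ore_add)
  next
    case (multY u)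
    then show ?case by (metis smash_to_ore_mult smash_to_ore_simps(2))
  qed
  then show ?thesis by (simp add: surj_def)
qed

section \<open>Ideals and congruence modulo \<open>H_ideal\<close>\<close>

lemma type_ring_simps [simp]:
  "carrier ring_of_type_algebra = UNIV" "x \<otimes>\<^bsub>ring_of_type_algebra\<^esub> y = x * y"
  "x \<oplus>\<^bsub>ring_of_type_algebra\<^esub> y = x + y" "\<zero>\<^bsub>ring_of_type_algebra\<^esub> = 0"
  "\<one>\<^bsub>ring_of_type_algebra\<^esub> = 1"
  by (simp_all add: ring_of_type_algebra_def)

lemma ideal_kernel:
  fixes h :: "'a::ring_1 \<Rightarrow> 'b::ring_1"
  assumes "\<And>u v. h (u + v) = h u + h v" "\<And>u v. h (u * v) = h u * h v" "h 1 = 1"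
  shows "ideal {u. h u = 0} ring_of_type_algebra"
proof -
  interpret ring_hom_ring ring_of_type_algebra ring_of_type_algebra h
    by (rule ring_hom_ringI) (simp_all add: ring_ring_of_type_algebra assms)
  have "a_kernel ring_of_type_algebra ring_of_type_algebra h = {u. h u = 0}"
    unfolding a_kernel_def' type_ring_simps by (simp only: UNIV_I simp_thms)
  then show ?thesis using kernel_is_ideal by (simp only:)
qed

lemma smash_ring_simps [simp]: "carrier smash_ring = UNIV" "x \<otimes>\<^bsub>smash_ring\<^esub> y = x * y"
  "x \<oplus>\<^bsub>smash_ring\<^esub> y = x + y" "\<zero>\<^bsub>smash_ring\<^esub> = 0" "\<one>\<^bsub>smash_ring\<^esub> = 1"
  by (simp_all add: smash_ring_def)

lemma
  fixes u v w :: "'f::field smash"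
  shows H_ideal_add: "u \<in> H_ideal \<Longrightarrow> v \<in> H_ideal \<Longrightarrow> u + v \<in> H_ideal"
    and H_ideal_0: "0 \<in> (H_ideal :: 'f smash set)"
    and H_ideal_mult: "u \<in> H_ideal \<Longrightarrow> w * u \<in> H_ideal" "u \<in> H_ideal \<Longrightarrow> u * w \<in> H_ideal"
proof -
  interpret ideal H_ideal "smash_ring :: 'f smash ring" by (rule ideal_H_ideal)
  show "u \<in> H_ideal \<Longrightarrow> v \<in> H_ideal \<Longrightarrow> u + v \<in> H_ideal"
    using additive_subgroup.a_closed[OF is_additive_subgroup, of u v] by simp
  show "0 \<in> (H_ideal :: 'f smash set)" using additive_subgroup.zero_closed[OF is_additive_subgroup] by simp
  show "u \<in> H_ideal \<Longrightarrow> w * u \<in> H_ideal" using I_l_closed[of u w] by simp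
  show "u \<in> H_ideal \<Longrightarrow> u * w \<in> H_ideal" using I_r_closed[of u w] by simp
qed

definition Hcong :: "'f::field smash \<Rightarrow> 'f smash \<Rightarrow> bool" (infix "\<simeq>\<^sub>H" 50) where
  "u \<simeq>\<^sub>H v \<longleftrightarrow> u - v \<in> H_ideal"

lemma Hcong_refl [simp]: "u \<simeq>\<^sub>H u"
  by (simp add: Hcong_def H_ideal_0)

lemma Hcong_trans [trans]: "u \<simeq>\<^sub>H v \<Longrightarrow> v \<simeq>\<^sub>H w \<Longrightarrow> u \<simeq>\<^sub>H w"
  using H_ideal_add[of "u - v" "v - w"] by (simp add: Hcong_def)

lemma Hcong_add: "u \<simeq>\<^sub>H v \<Longrightarrow> u' \<simeq>\<^sub>H v' \<Longrightarrow> u + u' \<simeq>\<^sub>H v + v'"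
  using H_ideal_add[of "u - v" "u' - v'"] by (simp add: Hcong_def algebra_simps)

lemma Hcong_mult_left: "u \<simeq>\<^sub>H v \<Longrightarrow> w * u \<simeq>\<^sub>H w * v"
  using H_ideal_mult(1)[of "u - v" w] by (simp add: Hcong_def algebra_simps)

lemma Hcong_mult_right: "u \<simeq>\<^sub>H v \<Longrightarrow> u * w \<simeq>\<^sub>H v * w"
  using H_ideal_mult(2)[of "u - v" w] by (simp add: Hcong_def algebra_simps)

lemma sx_sy: "sy * sx \<simeq>\<^sub>H sx * sy - sgrp (unip_elt (1 :: 'f::field))"
proof -
  interpret ring "smash_ring :: 'f smash ring"
    unfolding smash_ring_def by (rule ring_ring_of_type_algebra)
  have "sx * sy - sy * sx - sgrp (unip_elt 1) \<in> (H_ideal :: 'f smash set)"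
    unfolding H_ideal_def by (rule genideal_self') simp
  from H_ideal_mult(1)[OF this, of "-1"] show ?thesis
    by (simp add: Hcong_def algebra_simps)
qed

section \<open>Relations in the smash product\<close>

lemma sgrp_mult: "sgrp g * sgrp h = sgrp (g * h)"
  by (simp add: sgrp_def smash_elt_mult)

lemma unip_elt_add: "unip_elt (a + b) = unip_elt a * unip_elt b"
  by transfer (simp add: unip_mat_mult)

lemma unip_elt_entry: "unip_elt (entry g) = g"
  by transfer auto

lemma unip_elt_0: "unip_elt 0 = 1"
  by transfer (rule unip_mat_0)

lemma sconst_simps: "sconst 0 = 0" "sconst 1 = 1" "sconst (c + d) = sconst c + sconst d"
  "sconst (c * d) = sconst c * sconst d"
  by (simp_all add: sconst_def smash_elt_mult fconst_simps one_smash_elt act_def)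
    (simp_all add: smash_elt_def zero_smash_def single_add plus_smash.abs_eq)

lemma sconst_commute: "sconst c * u = u * sconst c"
proof (induction u rule: smash_induct)
  case (elt w d g)
  have "act h (fconst c) = fconst c" for h by (simp add: act_def)
  then show ?case by (simp add: sconst_def smash_elt_mult fconst_central)
qed (simp_all add: algebra_simps)

lemma sgrp_sx: "sgrp g * sx = sx * sgrp g"
  by (simp add: sgrp_def sx_def smash_elt_mult act_fgen)

lemma smash_elt_add: "smash_elt (u + v) g = smash_elt u g + smash_elt v g"
  by (simp add: smash_elt_def single_add plus_smash.abs_eq)

lemma sgrp_sy: "sgrp g * sy = (sy + sconst (to_ac (entry g)) * sx) * sgrp g"
  by (simp add: sgrp_def sx_def sy_def sconst_def smash_elt_mult act_fgen smash_elt_add distrib_right)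

lemma sgrp_1 [simp]: "sgrp 1 = 1"
  by (simp add: sgrp_def one_smash_elt)

section \<open>Normal forms in the smash product\<close>

definition grp_to_smash :: "'f::field grp_alg \<Rightarrow> 'f smash" where
  "grp_to_smash u = (\<Sum>a\<in>Poly_Mapping.keys u. sconst (Poly_Mapping.lookup u a) * sgrp (unip_elt a))"

lemma grp_to_smash_0 [simp]: "grp_to_smash 0 = 0"
  by (simp add: grp_to_smash_def)

lemma grp_to_smash_single [simp]:
  "grp_to_smash (Poly_Mapping.single a c) = sconst c * sgrp (unip_elt a)"
  by (cases "c = 0") (simp_all add: grp_to_smash_def sconst_simps)

lemma grp_to_smash_add [simp]: "grp_to_smash (u + v) = grp_to_smash u + grp_to_smash v"
  unfolding grp_to_smash_def
  by (rule setsum_keys_plus_distrib) (simp_all add: distrib_right sconst_simps)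

lemma grp_to_smash_1 [simp]: "grp_to_smash (1 :: 'f::field grp_alg) = 1"
  using grp_to_smash_single[of "0 :: 'f" 1] by (simp add: sconst_simps unip_elt_0)

lemma grp_to_smash_mult [simp]: "grp_to_smash (u * v) = grp_to_smash u * grp_to_smash v"
proof (induction u rule: pm_induct)
  case (single a c)
  show ?case
  proof (induction v rule: pm_induct)
    case (single b d)
    have "sconst c * sgrp (unip_elt a) * (sconst d * sgrp (unip_elt b)) =
        sconst c * (sgrp (unip_elt a) * sconst d) * sgrp (unip_elt b)"
      by (simp only: mult.assoc)
    also have "sgrp (unip_elt a) * sconst d = sconst d * sgrp (unip_elt a)"
      by (rule sconst_commute[symmetric])
    finally show ?case
      by (simp add: mult_single sconst_simps unip_elt_add mult.assoc sgrp_mult)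
  qed (simp_all add: distrib_left)
qed (simp_all add: distrib_right)

lemma grp_to_smash_sx: "grp_to_smash u * sx = sx * grp_to_smash u"
proof (induction u rule: pm_induct)
  case (single a c)
  then show ?case by (simp add: mult.assoc sgrp_sx) (metis mult.assoc sconst_commute)
qed (simp_all add: algebra_simps)

text \<open>Evaluation with coefficients on the left and powers of \<open>y\<close> on the right,
  which does not require \<open>y\<close> to commute with them. It serves for \<open>x\<close> over
  kE and for \<open>y\<close> over the base.\<close>

definition horner :: "('a::zero \<Rightarrow> 'b::ring_1) \<Rightarrow> 'b \<Rightarrow> 'a poly \<Rightarrow> 'b" where
  "horner h y P = fold_coeffs (\<lambda>a u. h a + u * y) P 0"

lemma horner_0 [simp]: "horner h y 0 = 0"
  by (simp add: horner_def)

lemma horner_pCons: "h 0 = 0 \<Longrightarrow> horner h y (pCons a P) = h a + horner h y P * y"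
  by (cases "a = 0"; cases "P = 0") (simp_all add: horner_def)

lemma horner_add:
  fixes h :: "'a::comm_monoid_add \<Rightarrow> 'b::ring_1"
  assumes "h 0 = 0" "\<And>a b. h (a + b) = h a + h b"
  shows "horner h y (P + Q) = horner h y P + horner h y Q"
  by (induction P Q rule: poly_induct2) (simp_all add: horner_pCons assms algebra_simps)

definition base_to_smash :: "'f::field base \<Rightarrow> 'f smash" where
  "base_to_smash = horner grp_to_smash sx"

lemma base_to_smash_0 [simp]: "base_to_smash 0 = 0"
  by (simp add: base_to_smash_def)

lemma base_to_smash_pCons [simp]:
  "base_to_smash (pCons u r) = grp_to_smash u + base_to_smash r * sx"
  by (simp add: base_to_smash_def horner_pCons)

lemma base_to_smash_add [simp]: "base_to_smash (r + s) = base_to_smash r + base_to_smash s"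
  unfolding base_to_smash_def by (rule horner_add) simp_all

lemma base_to_smash_smult [simp]: "base_to_smash (smult u r) = grp_to_smash u * base_to_smash r"
  by (induction r) (simp_all add: distrib_left mult.assoc)

lemma base_to_smash_sx: "base_to_smash r * sx = sx * base_to_smash r"
  by (induction r) (simp_all add: algebra_simps grp_to_smash_sx)

lemma base_to_smash_mult [simp]: "base_to_smash (r * s) = base_to_smash r * base_to_smash s"
  by (induction r) (simp_all add: distrib_right mult.assoc flip: base_to_smash_sx)

lemma base_to_smash_bK [simp]: "base_to_smash (bK c) = sconst c"
  by (simp add: bK_def unip_elt_0)

lemma base_to_smash_bG [simp]: "base_to_smash (bG a) = sgrp (unip_elt a)"
  by (simp add: bG_def sconst_simps)

lemma base_to_smash_bX [simp]: "base_to_smash bX = sx"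
  by simp

lemma base_to_smash_uminus: "base_to_smash (- r) = - base_to_smash r"
  using base_to_smash_add[of r "- r"] by (simp add: eq_neg_iff_add_eq_0 add.commute)

text \<open>Both sides are compatible with products by the Leibniz rule, so generators suffice. For
  scalars and group elements equality holds in the smash product itself; for \<open>x\<close> it is
  the defining relation of H.\<close>

lemma sy_base_to_smash:
  "sy * base_to_smash r \<simeq>\<^sub>H base_to_smash r * sy + base_to_smash (delta r)"
proof (induction r rule: base_induct)
  case (const c)
  show ?case by (simp add: sconst_commute)
next
  case (grp a)
  have "sy * sgrp (unip_elt a) = sgrp (unip_elt a) * sy - sconst (to_ac a) * sx * sgrp (unip_elt a)"
    using sgrp_sy[of "unip_elt a"] by (simp add: distrib_right)
  then show ?case
    by (simp add: delta_bG base_to_smash_uminus del: base_to_smash_pCons mult_pCons_left mult_pCons_right)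
next
  case var
  show ?case using sx_sy[where ?'f = 'a]
    by (simp add: base_to_smash_uminus del: base_to_smash_pCons)
next
  case (add r s)
  then show ?case using Hcong_add[OF add] by (simp add: algebra_simps)
next
  case (mult r s)
  have "sy * base_to_smash (r * s) = (sy * base_to_smash r) * base_to_smash s"
    by (simp add: mult.assoc)
  also have "\<dots> \<simeq>\<^sub>H (base_to_smash r * sy + base_to_smash (delta r)) * base_to_smash s"
    by (rule Hcong_mult_right[OF mult(1)])
  also have "\<dots> = base_to_smash r * (sy * base_to_smash s) + base_to_smash (delta r) * base_to_smash s"
    by (simp add: algebra_simps)
  also have "\<dots> \<simeq>\<^sub>H base_to_smash r * (base_to_smash s * sy + base_to_smash (delta s))
      + base_to_smash (delta r) * base_to_smash s"
    by (intro Hcong_add Hcong_mult_left mult(2) Hcong_refl)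
  also have "\<dots> = base_to_smash (r * s) * sy + base_to_smash (delta (r * s))"
    by (simp add: delta_mult distrib_left distrib_right mult.assoc
        add.assoc add.commute add.left_commute)
  finally show ?case .
qed

definition ore_to_smash :: "'f::field ore \<Rightarrow> 'f smash" where
  "ore_to_smash u = horner base_to_smash sy (ypoly u)"

lemma ore_to_smash_add: "ore_to_smash (u + v) = ore_to_smash u + ore_to_smash v"
  unfolding ore_to_smash_def ypoly_simps by (rule horner_add) simp_all

lemma ore_to_smash_ybase: "ore_to_smash (ybase r * u) = base_to_smash r * ore_to_smash u"
proof -
  have "horner base_to_smash sy (smult r P) = base_to_smash r * horner base_to_smash sy P" for P
    by (induction P) (simp_all add: horner_pCons distrib_left mult.assoc)
  then show ?thesis by (simp add: ore_to_smash_def)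
qed

lemma ore_to_smash_oY: "sy * ore_to_smash u \<simeq>\<^sub>H ore_to_smash (oY * u)"
proof -
  let ?h = "horner base_to_smash sy"
  note simps = horner_pCons[of base_to_smash, OF base_to_smash_0]
    horner_add[of base_to_smash, OF base_to_smash_0 base_to_smash_add]
  have "sy * ?h P \<simeq>\<^sub>H ?h (ydel P)" for P
  proof (induction P)
    case (pCons r P)
    have "sy * ?h (pCons r P) = sy * base_to_smash r + (sy * ?h P) * sy"
      by (simp add: simps algebra_simps)
    also have "\<dots> \<simeq>\<^sub>H (base_to_smash r * sy + base_to_smash (delta r)) + ?h (ydel P) * sy"
      by (intro Hcong_add Hcong_mult_right sy_base_to_smash pCons.IH)
    also have "\<dots> = ?h (ydel (pCons r P))"
      by (simp add: ydel_pCons simps algebra_simps)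
    finally show ?case .
  qed simp
  then show ?thesis by (simp add: ore_to_smash_def)
qed

text \<open>The claim survives left multiplication by each generator, so it is built up from the
  group element through the letters of the word to the scalar in front.\<close>

lemma smash_normal_form: "u \<simeq>\<^sub>H ore_to_smash (smash_to_ore u)"
proof (induction u rule: smash_induct)
  case zero
  show ?case by (simp add: ore_to_smash_def)
next
  case (elt w c g)
  let ?T = "\<lambda>u. u \<simeq>\<^sub>H ore_to_smash (smash_to_ore u)"
  have base: "?T (s * u)" if u: "?T u" and "s = base_to_smash r" "smash_to_ore s = ybase r" for s r u
    using Hcong_mult_left[OF u, of s] that by (simp add: ore_to_smash_ybase)
  have gen: "?T (smash_elt (fgen i) 1 * u)" if u: "?T u" for i u
  proof (cases i)
    case GX
    then show ?thesis using base[OF u, of sx bX] by (simp add: sx_def ogen_def del: base_to_smash_pCons)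
  next
    case GY
    have "sy * u \<simeq>\<^sub>H sy * ore_to_smash (smash_to_ore u)" by (rule Hcong_mult_left[OF u])
    also have "\<dots> \<simeq>\<^sub>H ore_to_smash (oY * smash_to_ore u)" by (rule ore_to_smash_oY)
    finally show ?thesis using GY by (simp add: ogen_def sy_def)
  qed
  have one: "?T 1"
    by (simp add: ore_to_smash_def horner_pCons one_pCons)
  have "?T (sgrp g)"
    using base[OF one, of "sgrp g" "bG (entry g)"] by (simp add: unip_elt_entry)
  then have word: "?T (prod_list (map (\<lambda>i. smash_elt (fgen i) 1) is) * sgrp g)" for "is"
    by (induction "is") (simp_all only: list.map prod_list.Nil prod_list.Cons mult_1 mult.assoc gen)
  have "?T (sconst c * (prod_list (map (\<lambda>i. smash_elt (fgen i) 1) (letters w)) * sgrp g))"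
    using base[OF word[of "letters w"], of "sconst c" "bK c"] by simp
  moreover have "prod_list (map (\<lambda>i. smash_elt (fgen i) 1) is) = smash_elt (prod_list (map fgen is)) 1"
    for "is" :: "gen list"
    by (induction "is") (simp_all add: smash_elt_mult one_smash_elt)
  moreover have "smash_elt (Poly_Mapping.single w c) g
      = sconst c * (smash_elt (prod_list (map fgen (letters w))) 1 * sgrp g)"
    by (simp add: sconst_def sgrp_def smash_elt_mult prod_list_fgen fconst_def mult_single)
  ultimately show ?case by metis
next
  case (add u v)
  then show ?case using Hcong_add[OF add] by (simp add: ore_to_smash_add)
qed

text \<open>The defining relation maps to zero. Conversely, an element with image zero is congruent
  to the lift of zero. With surjectivity this identifies H with the Ore extension.\<close>

lemma H_ideal_eq_kernel: "H_ideal = {u :: 'f::field smash. smash_to_ore u = 0}"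
proof (intro equalityI subsetI)
  fix u :: "'f smash" assume u: "u \<in> H_ideal"
  interpret ring "smash_ring :: 'f smash ring"
    unfolding smash_ring_def by (rule ring_ring_of_type_algebra)
  have "ideal {u :: 'f smash. smash_to_ore u = 0} smash_ring"
    unfolding smash_ring_def by (rule ideal_kernel) simp_all
  moreover have "sx * sy - sy * sx - sgrp (unip_elt 1) \<in> {u :: 'f smash. smash_to_ore u = 0}"
    by (simp add: oX_oY)
  ultimately have "H_ideal \<subseteq> {u :: 'f smash. smash_to_ore u = 0}"
    unfolding H_ideal_def by (intro genideal_minimal) auto
  then show "u \<in> {u. smash_to_ore u = 0}" using u by blast
next
  fix u :: "'f smash" assume "u \<in> {u. smash_to_ore u = 0}"
  then show "u \<in> H_ideal"
    using smash_normal_form[of u] by (simp add: Hcong_def ore_to_smash_def)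
qed

section \<open>Transport to the quotients\<close>

lemma kernel_coset:
  fixes h :: "'a::ring_1 \<Rightarrow> 'b::ring_1"
  assumes "\<And>u v. h (u + v) = h u + h v"
  shows "{u. h u = 0} +>\<^bsub>ring_of_type_algebra\<^esub> v = {u. h u = h v}"
proof -
  have diff: "h (u - v) = h u - h v" for u v
    using assms[of "u - v" v] by simp
  have "{u. h u = 0} +>\<^bsub>ring_of_type_algebra\<^esub> v = (\<lambda>u. u + v) ` {u. h u = 0}"
    by (auto simp: a_r_coset_def')
  also have "\<dots> = {u. h u = h v}"
    by (auto simp: assms diff intro!: image_eqI[of _ _ "_ - v"])
  finally show ?thesis .
qed

text \<open>\<open>h\<close> identifies one quotient with the target ring, and \<open>t\<close>
  identifies the other with the center of that ring. The resulting isomorphism is pinned down by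
  matching images \<open>t f = h u\<close>.\<close>

lemma quotient_center_iso:
  fixes h :: "'s::ring_1 \<Rightarrow> 'o::ring_1" and t :: "'q::ring_1 \<Rightarrow> 'o"
  assumes h: "\<And>u v. h (u + v) = h u + h v" "\<And>u v. h (u * v) = h u * h v" "h 1 = 1" "surj h"
    and t: "\<And>f g. t (f + g) = t f + t g" "\<And>f g. t (f * g) = t f * t g" "t 1 = 1"
      "range t = {z. \<forall>u. z * u = u * z}"
  defines "I \<equiv> {u. h u = 0}" and "J \<equiv> {f. t f = 0}"
  shows "\<exists>\<phi>\<in>ring_iso (ring_of_type_algebra Quot J) (center_ring (ring_of_type_algebra Quot I)).
    \<forall>f u. t f = h u \<longrightarrow> \<phi> (J +>\<^bsub>ring_of_type_algebra\<^esub> f) = I +>\<^bsub>ring_of_type_algebra\<^esub> u"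
proof -
  let ?P = "ring_of_type_algebra :: 'q ring" and ?S = "ring_of_type_algebra :: 's ring"
  let ?K = "?S Quot I" and ?L = "?P Quot J"
  interpret I: ideal I ?S unfolding I_def by (rule ideal_kernel) (fact h)+
  interpret J: ideal J ?P unfolding J_def by (rule ideal_kernel) (fact t)+
  define c where "c = (\<lambda>u. I +>\<^bsub>?S\<^esub> u)"
  define d where "d = (\<lambda>f. J +>\<^bsub>?P\<^esub> f)"
  have c_hom: "c \<in> ring_hom ?S ?K" and d_hom: "d \<in> ring_hom ?P ?L"
    unfolding c_def d_def by (rule I.rcos_ring_hom J.rcos_ring_hom)+
  have c_simps: "c u \<oplus>\<^bsub>?K\<^esub> c v = c (u + v)" "c u \<otimes>\<^bsub>?K\<^esub> c v = c (u * v)" "\<one>\<^bsub>?K\<^esub> = c 1" for u v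
    using ring_hom_add[OF c_hom, of u v] ring_hom_mult[OF c_hom, of u v] ring_hom_one[OF c_hom]
    by simp_all
  have d_simps: "d f \<oplus>\<^bsub>?L\<^esub> d g = d (f + g)" "d f \<otimes>\<^bsub>?L\<^esub> d g = d (f * g)" "\<one>\<^bsub>?L\<^esub> = d 1" for f g
    using ring_hom_add[OF d_hom, of f g] ring_hom_mult[OF d_hom, of f g] ring_hom_one[OF d_hom]
    by simp_all
  have c_eq: "c u = {v. h v = h u}" and d_eq: "d f = {g. t g = t f}" for u f
    unfolding c_def d_def I_def J_def by (rule kernel_coset, fact)+
  have c_iff: "c u = c v \<longleftrightarrow> h u = h v" and d_iff: "d f = d g \<longleftrightarrow> t f = t g" for u v f g
    unfolding c_eq d_eq by auto
  have carrier_K: "carrier ?K = range c" and carrier_L: "carrier ?L = range d"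
    by (auto simp: FactRing_def A_RCOSETS_def' c_def d_def)
  \<comment> \<open>Equality of cosets is equality under \<open>h\<close>, and surjectivity turns
    commuting with all \<open>h v\<close> into centrality in the target.\<close>
  have center_iff: "c u \<in> center ?K \<longleftrightarrow> h u \<in> range t" for u
  proof -
    have "c u \<in> center ?K \<longleftrightarrow> (\<forall>v. h u * h v = h v * h u)"
      by (simp add: center_def carrier_K c_simps c_iff h(2))
    also have "\<dots> \<longleftrightarrow> (\<forall>z. h u * z = z * h u)"
      using h(4) by (metis surjD)
    finally show ?thesis by (simp add: t(4))
  qed
  \<comment> \<open>The choice is unambiguous because cosets are exactly the fibres of
    \<open>t\<close> and \<open>h\<close>.\<close>
  define F where "F = (\<lambda>C. SOME D. \<exists>f u. C = d f \<and> D = c u \<and> t f = h u)"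
  have phi: "F (d f) = c u" if "t f = h u" for f u
    unfolding F_def
  proof (rule some_equality)
    show "\<exists>f' u'. d f = d f' \<and> c u = c u' \<and> t f' = h u'" using that by blast
  next
    fix D assume "\<exists>f' u. d f = d f' \<and> D = c u \<and> t f' = h u"
    then obtain f' u' where "d f = d f'" "D = c u'" "t f' = h u'" by blast
    with that show "D = c u" by (metis c_iff d_iff)
  qed
  have lift: "\<exists>u. t f = h u" for f using h(4) by (metis surjD)
  have "F \<in> ring_hom ?L (center_ring ?K)"
  proof (rule ring_hom_memI)
    fix V assume "V \<in> carrier ?L"
    then obtain f where V: "V = d f" by (auto simp: carrier_L)
    obtain u where u: "t f = h u" using lift by blast
    then have "h u \<in> range t" by (metis rangeI)
    then show "F V \<in> carrier (center_ring ?K)"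
      by (simp add: V phi[OF u] center_ring_def center_iff)
    fix W assume "W \<in> carrier ?L"
    then obtain g where W: "W = d g" by (auto simp: carrier_L)
    obtain v where v: "t g = h v" using lift by blast
    show "F (V \<otimes>\<^bsub>?L\<^esub> W) = F V \<otimes>\<^bsub>center_ring ?K\<^esub> F W"
      by (simp add: V W phi[OF u] phi[OF v] center_ring_def c_simps d_simps phi t(2) h(2) u v)
    show "F (V \<oplus>\<^bsub>?L\<^esub> W) = F V \<oplus>\<^bsub>center_ring ?K\<^esub> F W"
      by (simp add: V W phi[OF u] phi[OF v] center_ring_def c_simps d_simps phi t(1) h(1) u v)
  next
    show "F \<one>\<^bsub>?L\<^esub> = \<one>\<^bsub>center_ring ?K\<^esub>"
      by (simp add: center_ring_def c_simps d_simps phi t(3) h(3))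
  qed
  moreover have "bij_betw F (carrier ?L) (carrier (center_ring ?K))"
    unfolding bij_betw_def
  proof
    show "inj_on F (carrier ?L)"
    proof (rule inj_onI)
      fix V W assume "V \<in> carrier ?L" "W \<in> carrier ?L" and eq: "F V = F W"
      then obtain f g where VW: "V = d f" "W = d g" by (auto simp: carrier_L)
      obtain u v where uv: "t f = h u" "t g = h v" using lift by blast
      show "V = W" using eq by (simp add: VW phi[OF uv(1)] phi[OF uv(2)] c_iff d_iff uv)
    qed
    show "F ` carrier ?L = carrier (center_ring ?K)"
    proof (intro equalityI subsetI)
      fix Z assume "Z \<in> F ` carrier ?L"
      then obtain f where Z: "Z = F (d f)" by (auto simp: carrier_L)
      obtain u where u: "t f = h u" using lift by blast
      then have "h u \<in> range t" by (metis rangeI)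
      then show "Z \<in> carrier (center_ring ?K)"
        by (simp add: Z phi[OF u] center_ring_def center_iff)
    next
      fix Z assume "Z \<in> carrier (center_ring ?K)"
      then have Z: "Z \<in> center ?K" by (simp add: center_ring_def)
      then obtain u where u: "Z = c u" by (auto simp: center_def carrier_K)
      with Z obtain f where "t f = h u" by (metis center_iff imageE)
      then have "Z = F (d f)" by (simp add: u phi)
      then show "Z \<in> F ` carrier ?L" by (simp add: carrier_L)
    qed
  qed
  ultimately have "F \<in> ring_iso ?L (center_ring ?K)" by (simp add: ring_iso_def)
  with phi show ?thesis unfolding c_def d_def by blast
qed

section \<open>The isomorphism and its values on the generators\<close>

theorem theorem6p12:
  fixes p r :: nat and \<xi> :: "'f::{field,finite}" and zs :: "'f list"
  assumes "prime p" and "odd p" and "r > 1"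
    and "CARD('f) = p ^ r"
    and "range (\<lambda>n::int. \<xi> powi n) = UNIV - {0}"
    and "set zs = Xi \<xi> r" and "distinct zs"
  shows "C_elt p zs \<in> center (H_ring :: 'f smash set ring) \<and>
    (\<exists>\<phi> \<in> ring_iso (poly3_ring Quot rel_ideal p) (center_ring (H_ring :: 'f smash set ring)).
       (\<forall>c. \<phi> (pproj p (pconst c)) = H_proj (sconst c)) \<and>
       \<phi> (pproj p (pvar VA)) = A_elt \<and>
       \<phi> (pproj p (pvar VB)) = B_elt p \<and>
       \<phi> (pproj p (pvar VC)) = C_elt p zs)"
proof -
  have "r > 0" using assms(3) by simp
  note hyps = assms(1,2) this assms(4-7)
  note [simp] = center_map_pconst[OF hyps] center_map_pvar[OF hyps]
  \<comment> \<open>The matching condition yields all prescribed values: each reduces to an equality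
    of two images in the Ore extension.\<close>
  have "\<exists>\<phi> \<in> ring_iso (poly3_ring Quot rel_ideal p) (center_ring (H_ring :: 'f smash set ring)).
    \<forall>f u. center_map p zs f = smash_to_ore u \<longrightarrow> \<phi> (pproj p f) = H_proj u"
    unfolding H_ring_def H_proj_def pproj_def poly3_ring_def smash_ring_def H_ideal_eq_kernel
      kernel_center_map[OF hyps]
    by (rule quotient_center_iso)
      (simp_all add: surj_smash_to_ore center_map_add center_map_mult[OF hyps] center_map_1[OF hyps]
        range_center_map[OF hyps])
  then obtain \<phi> where iso: "\<phi> \<in> ring_iso (poly3_ring Quot rel_ideal p) (center_ring (H_ring :: 'f smash set ring))"
    and phi: "\<And>f u. center_map p zs f = smash_to_ore u \<Longrightarrow> \<phi> (pproj p f) = H_proj u" by blast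
  have pow: "smash_to_ore (u ^ n) = smash_to_ore u ^ n" for u :: "'f smash" and n
    by (induction n) simp_all
  have prod: "smash_to_ore (prod_list us) = prod_list (map smash_to_ore us)" for us :: "'f smash list"
    by (induction us) simp_all
  have two: "smash_to_ore 2 = (2 :: 'f ore)" "ybase 2 = (2 :: 'f ore)"
    using smash_to_ore_add[of 1 1] ybase_simps(3)[of 1 1] by simp_all
  have C: "smash_to_ore (\<Prod>\<zeta>\<leftarrow>zs. \<Prod>a\<leftarrow>[1..<p + 1]. sy - sconst (to_ac (\<zeta> + of_nat a)) * sx) = oC p zs"
    by (simp add: prod comp_def oC_def oD_def ofactor_def del: upt_Suc)
  have phi_C: "\<phi> (pproj p (pvar VC)) = C_elt p zs"
    unfolding C_elt_def by (rule phi) (simp only: C center_map_pvar[OF hyps])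
  have phi_A: "\<phi> (pproj p (pvar VA)) = A_elt"
    unfolding A_elt_def by (rule phi) (simp add: pow two bA_def del: mult_pCons_left mult_pCons_right)
  have phi_B: "\<phi> (pproj p (pvar VB)) = B_elt p"
    unfolding B_elt_def by (rule phi) (simp add: pow)
  have phi_const: "\<phi> (pproj p (pconst c)) = H_proj (sconst c)" for c
    by (rule phi) simp
  \<comment> \<open>Centrality of \<open>C\<close> in H is read off from its being a value of the
    isomorphism onto the center.\<close>
  have "pproj p (pvar VC) \<in> carrier (poly3_ring Quot rel_ideal p :: 'f poly3 set ring)"
    by (auto simp: FactRing_def A_RCOSETS_def' pproj_def poly3_ring_def)
  then have "\<phi> (pproj p (pvar VC)) \<in> carrier (center_ring (H_ring :: 'f smash set ring))"
    using iso by (metis ring_hom_closed ring_iso_memE(1))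
  then have "C_elt p zs \<in> center (H_ring :: 'f smash set ring)"
    by (simp add: phi_C center_ring_def)
  then show ?thesis
    using iso phi_A phi_B phi_C phi_const by blast
qed

end
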